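(* Assume there exist probability measures $(\nu_s)_{s\in I}$ with $\nu_s\in\mathcal M_1(E_s)$ for each $s\in I$, and constants $t_0\in I$, $t_0>0$, $c_1>0$, $c_2>0$, such that (A'1) for all $s\in I$ and $x\in E_s$, $\mathbb P_{s,x}(X_{s+t_0}\in\cdot\mid\tau_A>s+t_0)\ge c_1\,\nu_{s+t_0}$; (A'2) for all $s\le t$ in $I$ and all $x\in E_s$, $\mathbb P_{s,\nu_s}(\tau_A>t)\ge c_2\,\mathbb P_{s,x}(\tau_A>t)$. Then there is a $Q$-process, i.e. there exists a family of probability measures $(\mathbb Q_{s,x})_{s\in I,\,x\in E_s}$ such that for all $s\le t$ in $I$ and $x\in E_s$, $\mathbb P_{s,x}(X_{[s,t]}\in\cdot\mid\tau_A>T)$ converges weakly to $\mathbb Q_{s,x}(X_{[s,t]}\in\cdot)$ as $T\to\infty$, $T\in I$. Furthermore, there exist $C,\lambda>0$ such that for all $s\le t\le T$ in $I$ and all $x\in E_s$, $$\big\|\mathbb P_{s,x}(X_{[s,t]}\in\cdot\mid\tau_A>T)-\mathbb Q_{s,x}(X_{[s,t]}\in\cdot)\big\|_{TV}\le C e^{-\lambda(T-t)}.$$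
   Context: Let $I=\mathbb Z_+$ or $\mathbb R_+$. $(X_t)_{t\in I}$ is a time-homogeneous Markov process on a metric space $(E,d)$ equipped with a $\sigma$-algebra $\mathcal E$, and $\mathcal F_t=\sigma(X_u,\,0\le u\le t)$. For $s\in I$, $x\in E$, $\mathbb P_{s,x}$ is the law of the process started from $x$ at time $s$ ($\mathbb P_{s,x}(X_s=x)=1$; by time-homogeneity $(X_{s+u})_{u\in I}$ under $\mathbb P_{s,x}$ has the law of $(X_u)_{u\in I}$ under $\mathbb P_{0,x}$). For a measure $\mu$ put $\mathbb P_{s,\mu}=\int\mathbb P_{s,x}\,\mu(dx)$. For $F\subset E$, $\mathcal M_1(F)$ is the set of probability measures on $F$. For each $t\in I$, $A_t\in\mathcal E$ is the absorbing subset at time $t$, $E_t=E\setminus A_t$, and $\tau_A=\inf\{t\in I: X_t\in A_t\}$ (under $\mathbb P_{s,\cdot}$ the infimum is over $t\ge s$). It is assumed throughout that $\tau_A$ is an $(\mathcal F_t)$-stopping time, that $\mathbb P_{s,x}(\tau_A<\infty)=1$ for all $s\in I$, $x\in E_s$, and that $\mathbb P_{s,x}(\tau_A>t)>0$ for all $s\le t$, $x\in E_s$. $X_{[s,t]}$ denotes the trajectory of $X$ between times $s$ and $t$. An inequality between measures is meant setwise. The total variation distance is $\|\mu-\nu\|_{TV}=\sup\{|\mu(f)-\nu(f)| : f \text{ measurable},\ \|f\|_\infty\le1\}$. *)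

theory Defs
  imports "HOL-Probability.Probability"
begin

section \<open>Markov processes absorbed at a moving boundary\<close>

text \<open>
  Times are reals in a set \<open>I\<close>, which is either \<open>\<nat>\<close> or \<open>{0..}\<close>. The state space is
  a metric space, given as a type; its \<open>\<sigma>\<close>-algebra \<open>\<E>\<close> is arbitrary and need not be the Borel one.
\<close>

definition natural_sigma ::
    "'w set \<Rightarrow> 'e measure \<Rightarrow> (real \<Rightarrow> 'w \<Rightarrow> 'e) \<Rightarrow> real set \<Rightarrow> 'w measure" where
  "natural_sigma \<Omega> \<E> X J = sigma \<Omega> {X u -` B \<inter> \<Omega> | u B. u \<in> J \<and> B \<in> sets \<E>}"

text \<open>
  The law \<open>P s x\<close> of the process started from \<open>x\<close> at time \<open>s\<close> is a measure on the
  \<open>\<sigma>\<close>-algebra generated by the \<open>X u\<close> with \<open>u \<ge> s\<close>; nothing is said about the process before time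
  \<open>s\<close> under \<open>P s x\<close>. Singletons need not be measurable, whence the almost-everywhere formulation of
  the initial condition.
\<close>

locale homogeneous_markov_process =
  fixes I :: "real set"
    and \<Omega> :: "'w set"
    and \<E> :: "('e::metric_space) measure"
    and X :: "real \<Rightarrow> 'w \<Rightarrow> 'e"
    and P :: "real \<Rightarrow> 'e \<Rightarrow> 'w measure"
  assumes time_set: "I = \<nat> \<or> I = {0..}"
    and space_state: "space \<E> = UNIV"
    and kernel: "s \<in> I \<Longrightarrow> P s \<in> \<E> \<rightarrow>\<^sub>M prob_algebra (natural_sigma \<Omega> \<E> X (I \<inter> {s..}))"
    and initial: "s \<in> I \<Longrightarrow> AE \<omega> in P s x. X s \<omega> = x"
    and markov: "\<lbrakk>s \<in> I; t \<in> I; u \<in> I; s \<le> t; t \<le> u; B \<in> sets \<E>\<rbrakk> \<Longrightarrow>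
      AE \<omega> in P s x.
        real_cond_exp (P s x) (natural_sigma \<Omega> \<E> X (I \<inter> {s..t}))
          (indicator {\<omega>' \<in> \<Omega>. X u \<omega>' \<in> B}) \<omega>
        = \<P>(\<omega>' in P t (X t \<omega>). X u \<omega>' \<in> B)"
    and homogeneous: "s \<in> I \<Longrightarrow>
      distr (P s x) (PiM I (\<lambda>_. \<E>)) (\<lambda>\<omega>. \<lambda>u\<in>I. X (s + u) \<omega>)
      = distr (P 0 x) (PiM I (\<lambda>_. \<E>)) (\<lambda>\<omega>. \<lambda>u\<in>I. X u \<omega>)"

definition hitting_time ::
    "real set \<Rightarrow> (real \<Rightarrow> 'w \<Rightarrow> 'e) \<Rightarrow> (real \<Rightarrow> 'e set) \<Rightarrow> real \<Rightarrow> 'w \<Rightarrow> ereal" where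
  "hitting_time I X A s \<omega> = Inf {ereal t | t. t \<in> I \<and> s \<le> t \<and> X t \<omega> \<in> A t}"

text \<open>
  For every starting time \<open>s\<close> the absorption time is a stopping time of the filtration
  generated by the process from time \<open>s\<close> on; for \<open>s = 0\<close> this is the natural filtration.
\<close>

locale absorbed_markov_process =
  homogeneous_markov_process I \<Omega> \<E> X P
  for I :: "real set"
    and \<Omega> :: "'w set"
    and \<E> :: "('e::metric_space) measure"
    and X :: "real \<Rightarrow> 'w \<Rightarrow> 'e"
    and P :: "real \<Rightarrow> 'e \<Rightarrow> 'w measure" +
  fixes A :: "real \<Rightarrow> 'e set"
  assumes absorbing_sets: "t \<in> I \<Longrightarrow> A t \<in> sets \<E>"
    and absorption_stopping_time: "\<lbrakk>s \<in> I; t \<in> I; s \<le> t\<rbrakk> \<Longrightarrow>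
      Measurable.pred (natural_sigma \<Omega> \<E> X (I \<inter> {s..t})) (\<lambda>\<omega>. hitting_time I X A s \<omega> \<le> ereal t)"
    and absorption_finite: "\<lbrakk>s \<in> I; x \<in> - A s\<rbrakk> \<Longrightarrow>
      \<P>(\<omega> in P s x. hitting_time I X A s \<omega> < \<infinity>) = 1"
    and survival_pos: "\<lbrakk>s \<in> I; t \<in> I; s \<le> t; x \<in> - A s\<rbrakk> \<Longrightarrow>
      \<P>(\<omega> in P s x. hitting_time I X A s \<omega> > ereal t) > 0"

text \<open>
  \<open>cond_path_law I \<E> X P A s x t T\<close> is the law of the trajectory \<open>X\<^bsub>[s,t]\<^esub>\<close> under
  \<open>P s x\<close> conditioned on survival up to time \<open>T\<close>, on the product \<open>\<sigma>\<close>-algebra of \<open>E\<^bsup>[s,t] \<inter> I\<^esup>\<close>.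
\<close>

definition cond_path_law ::
    "real set \<Rightarrow> 'e measure \<Rightarrow> (real \<Rightarrow> 'w \<Rightarrow> 'e) \<Rightarrow> (real \<Rightarrow> 'e \<Rightarrow> 'w measure) \<Rightarrow>
     (real \<Rightarrow> 'e set) \<Rightarrow> real \<Rightarrow> 'e \<Rightarrow> real \<Rightarrow> real \<Rightarrow> (real \<Rightarrow> 'e) measure" where
  "cond_path_law I \<E> X P A s x t T =
    distr
      (uniform_measure (P s x) {\<omega> \<in> space (P s x). hitting_time I X A s \<omega> > ereal T})
      (PiM (I \<inter> {s..t}) (\<lambda>_. \<E>))
      (\<lambda>\<omega>. \<lambda>u\<in>I \<inter> {s..t}. X u \<omega>)"

text \<open>
  The probability measures on a measurable subset \<open>F\<close>, viewed as the probability measures on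
  the whole space that give \<open>F\<close> full mass.
\<close>

definition prob_measures_on :: "'a measure \<Rightarrow> 'a set \<Rightarrow> 'a measure set" where
  "prob_measures_on M F = {\<mu> \<in> space (prob_algebra M). measure \<mu> F = 1}"

text \<open>
  Weak convergence tests against bounded continuous functions. They are also required to be
  measurable, because the \<open>\<sigma>\<close>-algebra is not assumed to be related to the topology.
\<close>

definition weakly_converges ::
    "'a topology \<Rightarrow> 'a measure \<Rightarrow> ('i \<Rightarrow> 'a measure) \<Rightarrow> 'a measure \<Rightarrow> 'i filter \<Rightarrow> bool" where
  "weakly_converges \<T> M \<mu> \<nu> F \<longleftrightarrow>
    (\<forall>f. continuous_map \<T> euclideanreal f \<longrightarrow> f \<in> borel_measurable M \<longrightarrow>
       bounded (f ` topspace \<T>) \<longrightarrow>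
       ((\<lambda>i. \<integral>y. f y \<partial>\<mu> i) \<longlongrightarrow> (\<integral>y. f y \<partial>\<nu>)) F)"

text \<open>
  Total variation distance of two probability measures on the measurable space \<open>M\<close>, with the
  normalisation in which its maximal value is 2.
\<close>

definition tv_dist :: "'a measure \<Rightarrow> 'a measure \<Rightarrow> 'a measure \<Rightarrow> real" where
  "tv_dist M \<mu> \<nu> =
    (SUP f \<in> {f \<in> borel_measurable M. \<forall>y \<in> space M. \<bar>f y\<bar> \<le> 1}.
       \<bar>(\<integral>y. f y \<partial>\<mu>) - (\<integral>y. f y \<partial>\<nu>)\<bar>)"

text \<open>
  A \<open>Q\<close>-process. Each \<open>Q s x\<close> is the law of a process indexed by \<open>I \<inter> {s..}\<close>, that is, a
  probability measure on the path space \<open>E\<^bsup>I \<inter> {s..}\<^esup>\<close>, on which the process is the coordinate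
  process. It cannot be required to live on \<open>\<Omega>\<close>: absorption may be certain for every single
  \<open>\<omega> \<in> \<Omega>\<close>, whereas it has probability 0 for a \<open>Q\<close>-process.
\<close>

definition path_marginal ::
    "real set \<Rightarrow> 'e measure \<Rightarrow> (real \<Rightarrow> 'e) measure \<Rightarrow> real \<Rightarrow> real \<Rightarrow> (real \<Rightarrow> 'e) measure" where
  "path_marginal I \<E> R s t =
    distr R (PiM (I \<inter> {s..t}) (\<lambda>_. \<E>)) (\<lambda>w. restrict w (I \<inter> {s..t}))"

definition is_Q_process ::
    "real set \<Rightarrow> ('e::metric_space) measure \<Rightarrow> (real \<Rightarrow> 'w \<Rightarrow> 'e) \<Rightarrow> (real \<Rightarrow> 'e \<Rightarrow> 'w measure) \<Rightarrow>
     (real \<Rightarrow> 'e set) \<Rightarrow> (real \<Rightarrow> 'e \<Rightarrow> (real \<Rightarrow> 'e) measure) \<Rightarrow> bool" where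
  "is_Q_process I \<E> X P A Q \<longleftrightarrow>
    (\<forall>s\<in>I. \<forall>x \<in> - A s. Q s x \<in> space (prob_algebra (PiM (I \<inter> {s..}) (\<lambda>_. \<E>)))) \<and>
    (\<forall>s\<in>I. \<forall>t\<in>I. \<forall>x \<in> - A s. s \<le> t \<longrightarrow>
       weakly_converges (product_topology (\<lambda>_. euclidean) (I \<inter> {s..t})) (PiM (I \<inter> {s..t}) (\<lambda>_. \<E>))
         (\<lambda>T. cond_path_law I \<E> X P A s x t T)
         (path_marginal I \<E> (Q s x) s t)
         (inf at_top (principal I)))"

end

theory Submission
  imports Defs
begin

text \<open>
  Write \<open>S s t x = P s x (\<tau> > t)\<close>. For fixed \<open>T \<le> T'\<close> the ratio \<open>S u T' / S u T\<close> on \<open>E u\<close> is the average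
  of the ratio at time \<open>u + t0\<close> under the law conditioned on survival up to \<open>T\<close>; by (A'1) and (A'2)
  these averages have a common component of mass \<open>c1 c2\<close>, so the oscillation of the ratio contracts
  geometrically as \<open>u\<close> decreases. Its size relative to the ratio is controlled because the ratio lies between
  \<open>c1 B\<close> and \<open>B / c2\<close> with \<open>B = \<integral> S T T' d\<nu> T\<close>. Hence \<open>S t T y / \<integral> S 0 T d\<nu> 0\<close> converges as \<open>T \<rightarrow> \<infinity>\<close>
  with exponentially small relative error to some \<open>H t y > 0\<close>. The \<open>Q\<close>-process is the Doob transform of the
  killed process by \<open>H\<close>. Since no topology is available on the state space, its law on the infinite horizon
  is built with the Ionescu-Tulcea theorem from the transition kernels over unit time intervals.
\<close>

section \<open>Markov property with respect to the whole future\<close>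

text \<open>The Markov property is assumed for one future time and one measurable set, whereas
  survival up to \<open>T\<close> depends on a whole stretch of the trajectory, in continuous time
  on uncountably many times. It is therefore first extended to measurable functionals of past and
  future jointly; the stopping time assumption makes survival such a functional. The normalisation
  \<open>Z T = N 0 T\<close> works because \<open>Z T' / Z T\<close> is itself an average of the
  ratios \<open>S u T' / S u T\<close>. It falls into the same shrinking interval, so
  \<open>S u T' y / Z T'\<close> and \<open>S u T y / Z T\<close> can be compared without knowing
  how fast survival probabilities decay. All errors are kept relative. A relative error can be
  integrated against the killed kernel, which gives harmonicity of \<open>H\<close> without a
  domination argument, and a relative error below 1 gives \<open>H > 0\<close>. On [s,t] the
  conditioned law and the law of the \<open>Q\<close>-process are both the law of the killed
  trajectory reweighted by a function of \<open>X t\<close>, so comparing them amounts to comparing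
  two weights.\<close>

lemma space_natural_sigma [simp]: "space (natural_sigma \<Omega> \<E> X J) = \<Omega>"
  unfolding natural_sigma_def by (rule space_measure_of) auto

lemma sets_natural_sigma:
  "sets (natural_sigma \<Omega> \<E> X J) = sigma_sets \<Omega> {X u -` B \<inter> \<Omega> | u B. u \<in> J \<and> B \<in> sets \<E>}"
  unfolding natural_sigma_def by (rule sets_measure_of) auto

lemma sets_natural_sigma_mono:
  "J \<subseteq> K \<Longrightarrow> sets (natural_sigma \<Omega> \<E> X J) \<subseteq> sets (natural_sigma \<Omega> \<E> X K)"
  unfolding sets_natural_sigma by (rule sigma_sets_mono') auto

lemma measurable_natural_sigma_mono:
  assumes "f \<in> natural_sigma \<Omega> \<E> X J \<rightarrow>\<^sub>M N" "J \<subseteq> K"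
  shows "f \<in> natural_sigma \<Omega> \<E> X K \<rightarrow>\<^sub>M N"
  using assms sets_natural_sigma_mono[of J K \<Omega> \<E> X] by (auto simp: measurable_def)

lemma measurable_ident_natural_sigma:
  "J \<subseteq> K \<Longrightarrow> (\<lambda>\<omega>. \<omega>) \<in> natural_sigma \<Omega> \<E> X K \<rightarrow>\<^sub>M natural_sigma \<Omega> \<E> X J"
  using measurable_natural_sigma_mono[OF measurable_ident] by (simp add: id_def)

context homogeneous_markov_process
begin

abbreviation past :: "real \<Rightarrow> real \<Rightarrow> 'w measure" where
  "past s t \<equiv> natural_sigma \<Omega> \<E> X (I \<inter> {s..t})"

abbreviation future :: "real \<Rightarrow> 'w measure" where
  "future s \<equiv> natural_sigma \<Omega> \<E> X (I \<inter> {s..})"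

lemma measurable_X: "u \<in> J \<Longrightarrow> X u \<in> natural_sigma \<Omega> \<E> X J \<rightarrow>\<^sub>M \<E>"
  unfolding measurable_def sets_natural_sigma
  by (auto simp: space_state intro!: sigma_sets.Basic)

lemma past_future: "r \<le> s \<Longrightarrow> f \<in> past s t \<rightarrow>\<^sub>M N \<Longrightarrow> f \<in> future r \<rightarrow>\<^sub>M N"
  by (erule measurable_natural_sigma_mono) auto

lemma sets_past_mono: "r \<le> s \<Longrightarrow> t \<le> u \<Longrightarrow> G \<in> sets (past s t) \<Longrightarrow> G \<in> sets (past r u)"
  by (rule subsetD[OF sets_natural_sigma_mono[of "I \<inter> {s..t}" "I \<inter> {r..u}"]]) auto

lemma sets_past_future: "r \<le> s \<Longrightarrow> G \<in> sets (past s t) \<Longrightarrow> G \<in> sets (future r)"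
  by (rule subsetD[OF sets_natural_sigma_mono[of "I \<inter> {s..t}" "I \<inter> {r..}"]]) auto

lemma time_add: "s \<in> I \<Longrightarrow> t \<in> I \<Longrightarrow> s + t \<in> I"
  using time_set by (auto simp: Nats_add)

lemma time_diff: "s \<in> I \<Longrightarrow> t \<in> I \<Longrightarrow> s \<le> t \<Longrightarrow> t - s \<in> I"
  using time_set by (auto simp: Nats_diff)

lemma time_of_nat: "real n \<in> I"
  using time_set by auto

lemma time_nonneg: "s \<in> I \<Longrightarrow> 0 \<le> s"
  using time_set by (auto simp: Nats_def)

lemma prob_space_P: "s \<in> I \<Longrightarrow> prob_space (P s x)"
  and sets_P: "s \<in> I \<Longrightarrow> sets (P s x) = sets (future s)"
  using kernel[THEN measurable_space, of s x] by (auto simp: space_state space_prob_algebra)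

lemma space_P: "s \<in> I \<Longrightarrow> space (P s x) = \<Omega>"
  using sets_eq_imp_space_eq[OF sets_P[of s x]] by simp

lemma measurable_P: "s \<in> I \<Longrightarrow> f \<in> future s \<rightarrow>\<^sub>M N \<Longrightarrow> f \<in> P s x \<rightarrow>\<^sub>M N"
  using measurable_cong_sets[OF sets_P refl] by blast

lemma subprob_kernel: "s \<in> I \<Longrightarrow> P s \<in> \<E> \<rightarrow>\<^sub>M subprob_algebra (future s)"
  using kernel by (rule measurable_prob_algebraD)

lemma measurable_nn_integral_P:
  assumes "s \<in> I" "f \<in> borel_measurable (future s)"
  shows "(\<lambda>y. \<integral>\<^sup>+\<omega>. f \<omega> \<partial>P s y) \<in> borel_measurable \<E>"
  by (rule measurable_compose[OF subprob_kernel nn_integral_measurable_subprob_algebra]) (use assms in auto)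

text \<open>Trades the conditional expectation in \<open>markov\<close> for an integral identity
  over events \<open>G\<close> of the past, in \<open>ennreal\<close>, where no integrability has to
  be carried through the inductions below.\<close>

lemma markov_indicator:
  assumes st: "s \<in> I" "t \<in> I" "u \<in> I" "s \<le> t" "t \<le> u" and B: "B \<in> sets \<E>" and G: "G \<in> sets (past s t)"
  shows "(\<integral>\<^sup>+\<omega>. indicator G \<omega> * indicator B (X u \<omega>) \<partial>P s x) =
    (\<integral>\<^sup>+\<omega>. indicator G \<omega> * emeasure (P t (X t \<omega>)) (X u -` B \<inter> \<Omega>) \<partial>P s x)"
proof -
  interpret prob_space "P s x" by (rule prob_space_P) fact
  have sub: "subalgebra (P s x) (past s t)"
    unfolding subalgebra_def using st by (auto simp: space_P sets_P intro: sets_past_future)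
  interpret finite_measure_subalgebra "P s x" "past s t"
    by unfold_locales (rule sub)
  let ?F = "{\<omega>'\<in>\<Omega>. X u \<omega>' \<in> B}"
  have F: "?F \<in> sets (future t)" "?F \<in> sets (P s x)"
    using measurable_sets[OF measurable_X[of u] B, of "I \<inter> {t..}"]
      measurable_sets[OF measurable_X[of u] B, of "I \<inter> {s..}"] st
    by (auto simp: vimage_def Int_def conj_commute sets_P)
  have G': "G \<in> sets (P s x)" using G st by (auto simp: sets_P intro: sets_past_future)
  let ?q = "\<lambda>y. measure (P t y) ?F"
  have q: "?q \<in> borel_measurable \<E>"
    by (rule measurable_compose[OF kernel measurable_measure_prob_algebra]) (use st F in auto)
  have Xt: "X t \<in> P s x \<rightarrow>\<^sub>M \<E>" using st by (intro measurable_P measurable_X) auto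
  note qX [measurable] = measurable_compose[OF Xt q]
  note [measurable] = F(2) G'
  have q1: "?q y \<le> 1" for y using prob_space_P[of t y] st by (simp add: prob_space.prob_le_1)
  have "ennreal (measure (P s x) (?F \<inter> G)) = ennreal (\<integral>\<omega>\<in>G. indicator ?F \<omega> \<partial>P s x)"
    unfolding set_lebesgue_integral_def by (simp add: indicator_inter_arith[symmetric] Int_commute)
  also have "(\<integral>\<omega>\<in>G. indicator ?F \<omega> \<partial>P s x) =
      (\<integral>\<omega>\<in>G. real_cond_exp (P s x) (past s t) (indicator ?F) \<omega> \<partial>P s x)"
    by (rule real_cond_exp_intA) (use G F in \<open>auto simp: less_top[symmetric]\<close>)
  also have "\<dots> = (\<integral>\<omega>\<in>G. ?q (X t \<omega>) \<partial>P s x)"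
    unfolding set_lebesgue_integral_def
  proof (rule integral_cong_AE)
    show "AE \<omega> in P s x. indicat_real G \<omega> *\<^sub>R real_cond_exp (P s x) (past s t) (indicator ?F) \<omega> = indicat_real G \<omega> *\<^sub>R ?q (X t \<omega>)"
      using markov[OF st(1-5) B, of x] by eventually_elim (use st space_P in simp)
  qed auto
  also have "ennreal \<dots> = (\<integral>\<^sup>+\<omega>. ennreal (indicator G \<omega> * ?q (X t \<omega>)) \<partial>P s x)"
    unfolding set_lebesgue_integral_def
    by (subst nn_integral_eq_integral)
      (auto intro!: integrable_const_bound[of _ 1] simp: q1 mult_le_one indicator_def)
  also have "\<dots> = (\<integral>\<^sup>+\<omega>. indicator G \<omega> * emeasure (P t (X t \<omega>)) (X u -` B \<inter> \<Omega>) \<partial>P s x)"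
  proof (intro nn_integral_cong)
    fix \<omega>
    interpret Pt: prob_space "P t (X t \<omega>)" by (rule prob_space_P) fact
    show "ennreal (indicator G \<omega> * ?q (X t \<omega>)) = indicator G \<omega> * emeasure (P t (X t \<omega>)) (X u -` B \<inter> \<Omega>)"
      by (simp add: Pt.emeasure_eq_measure ennreal_mult' ennreal_indicator[symmetric] vimage_def Int_def conj_commute split: split_indicator)
  qed
  also have "ennreal (measure (P s x) (?F \<inter> G)) = (\<integral>\<^sup>+\<omega>. indicator (?F \<inter> G) \<omega> \<partial>P s x)"
    by (simp add: emeasure_eq_measure)
  also have "\<dots> = (\<integral>\<^sup>+\<omega>. indicator G \<omega> * indicator B (X u \<omega>) \<partial>P s x)"
    by (intro nn_integral_cong) (auto simp: space_P st split: split_indicator)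
  finally show ?thesis .
qed

text \<open>Both sides are integrals of \<open>f\<close> against a measure on the state space: the
  law of \<open>X u\<close> on \<open>G\<close>, and the mixture over \<open>G\<close> of the laws
  of \<open>X u\<close> started afresh from \<open>X t\<close> at time \<open>t\<close>. By
  \<open>markov_indicator\<close> these two measures coincide.\<close>

lemma markov_nn_integral:
  assumes st: "s \<in> I" "t \<in> I" "u \<in> I" "s \<le> t" "t \<le> u"
    and f: "f \<in> borel_measurable \<E>" and G: "G \<in> sets (past s t)"
  shows "(\<integral>\<^sup>+\<omega>. indicator G \<omega> * f (X u \<omega>) \<partial>P s x) =
    (\<integral>\<^sup>+\<omega>. indicator G \<omega> * (\<integral>\<^sup>+\<omega>'. f (X u \<omega>') \<partial>P t (X t \<omega>)) \<partial>P s x)"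
proof -
  let ?D = "density (P s x) (indicator G)" and ?K = "\<lambda>\<omega>. distr (P t (X t \<omega>)) \<E> (X u)"
  have G': "G \<in> sets (P s x)" using G st by (auto simp: sets_P intro: sets_past_future)
  note [measurable] = G'
  have Xu: "X u \<in> P s x \<rightarrow>\<^sub>M \<E>" "X t \<in> P s x \<rightarrow>\<^sub>M \<E>" "X u \<in> P t y \<rightarrow>\<^sub>M \<E>" for y
    using st by (auto intro!: measurable_P measurable_X)
  have kern: "(\<lambda>y. distr (P t y) \<E> (X u)) \<in> \<E> \<rightarrow>\<^sub>M subprob_algebra \<E>"
    by (rule measurable_compose[OF subprob_kernel measurable_distr]) (use st in \<open>auto intro!: measurable_X\<close>)
  have K: "?K \<in> ?D \<rightarrow>\<^sub>M subprob_algebra \<E>"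
    using measurable_compose[OF Xu(2) kern] by simp
  have ne: "space ?D \<noteq> {}" using prob_space.not_empty[OF prob_space_P, of s x] st by simp
  have eq: "distr ?D \<E> (X u) = ?D \<bind> ?K"
  proof (rule measure_eqI)
    show "sets (distr ?D \<E> (X u)) = sets (?D \<bind> ?K)"
      using sets_bind_measurable[OF K ne] by simp
    fix B assume "B \<in> sets (distr ?D \<E> (X u))"
    then have B[measurable]: "B \<in> sets \<E>" by simp
    have "emeasure (?D \<bind> ?K) B = (\<integral>\<^sup>+\<omega>. emeasure (?K \<omega>) B \<partial>?D)"
      by (rule emeasure_bind[OF ne K B])
    also have "\<dots> = (\<integral>\<^sup>+\<omega>. indicator G \<omega> * emeasure (P t (X t \<omega>)) (X u -` B \<inter> \<Omega>) \<partial>P s x)"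
      using measurable_compose[OF Xu(2) measurable_compose[OF kern measurable_emeasure_subprob_algebra[OF B]]]
      by (subst nn_integral_density) (auto simp: emeasure_distr Xu space_P st)
    also have "\<dots> = (\<integral>\<^sup>+\<omega>. indicator G \<omega> * indicator B (X u \<omega>) \<partial>P s x)"
      by (rule markov_indicator[symmetric]) fact+
    also have "\<dots> = (\<integral>\<^sup>+\<omega>. indicator B (X u \<omega>) \<partial>?D)"
      using Xu by (subst nn_integral_density) auto
    also have "\<dots> = (\<integral>\<^sup>+y. indicator B y \<partial>distr ?D \<E> (X u))"
      using Xu by (subst nn_integral_distr) auto
    finally show "emeasure (distr ?D \<E> (X u)) B = emeasure (?D \<bind> ?K) B" by simp
  qed
  have m: "(\<lambda>y. \<integral>\<^sup>+\<omega>'. f (X u \<omega>') \<partial>P t y) \<in> borel_measurable \<E>"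
    by (rule measurable_nn_integral_P) (use st f in \<open>auto intro!: measurable_compose[OF _ f] measurable_X\<close>)
  have "(\<integral>\<^sup>+\<omega>. indicator G \<omega> * f (X u \<omega>) \<partial>P s x) = (\<integral>\<^sup>+y. f y \<partial>distr ?D \<E> (X u))"
    using Xu f by (subst nn_integral_distr) (auto simp: nn_integral_density)
  also have "\<dots> = (\<integral>\<^sup>+\<omega>. (\<integral>\<^sup>+\<omega>'. f (X u \<omega>') \<partial>P t (X t \<omega>)) \<partial>?D)"
    unfolding eq using Xu f by (subst nn_integral_bind[OF _ K]) (auto simp: nn_integral_distr)
  also have "\<dots> = (\<integral>\<^sup>+\<omega>. indicator G \<omega> * (\<integral>\<^sup>+\<omega>'. f (X u \<omega>') \<partial>P t (X t \<omega>)) \<partial>P s x)"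
    using measurable_compose[OF Xu(2) m] by (subst nn_integral_density) auto
  finally show ?thesis .
qed

lemma sets_cylinder:
  assumes "finite U" "U \<subseteq> J" "B \<in> U \<rightarrow> sets \<E>"
  shows "{\<omega>\<in>\<Omega>. \<forall>u\<in>U. X u \<omega> \<in> B u} \<in> sets (natural_sigma \<Omega> \<E> X J)"
proof -
  have "{\<omega>\<in>space (natural_sigma \<Omega> \<E> X J). \<forall>u\<in>U. X u \<omega> \<in> B u} \<in> sets (natural_sigma \<Omega> \<E> X J)"
  proof (rule sets.sets_Collect_finite_All[OF _ \<open>finite U\<close>])
    fix u assume "u \<in> U"
    then have "X u -` B u \<inter> space (natural_sigma \<Omega> \<E> X J) \<in> sets (natural_sigma \<Omega> \<E> X J)"
      using assms by (intro measurable_sets[OF measurable_X]) auto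
    then show "{x \<in> space (natural_sigma \<Omega> \<E> X J). X u x \<in> B u} \<in> sets (natural_sigma \<Omega> \<E> X J)"
      by (simp add: vimage_def Int_def conj_commute)
  qed
  then show ?thesis by simp
qed

text \<open>Induction on the future times, removing the earliest, \<open>b\<close>. Conditioning at
  \<open>b\<close> replaces the later constraints by a function of \<open>X b\<close>, and
  \<open>markov_nn_integral\<close> moves that function from \<open>b\<close> back to
  \<open>t\<close>. The induction hypothesis serves twice, for the start at \<open>s\<close> and for
  the restart at \<open>t\<close>, so \<open>s\<close>, \<open>t\<close>, \<open>x\<close> and
  \<open>G\<close> are all generalised.\<close>

lemma markov_cylinder:
  assumes "finite U"
  shows "s \<in> I \<Longrightarrow> t \<in> I \<Longrightarrow> s \<le> t \<Longrightarrow> U \<subseteq> I \<inter> {t..} \<Longrightarrow> B \<in> U \<rightarrow> sets \<E> \<Longrightarrow> G \<in> sets (past s t) \<Longrightarrow>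
    emeasure (P s x) (G \<inter> {\<omega>\<in>\<Omega>. \<forall>u\<in>U. X u \<omega> \<in> B u}) =
    (\<integral>\<^sup>+\<omega>. indicator G \<omega> * emeasure (P t (X t \<omega>)) {\<omega>'\<in>\<Omega>. \<forall>u\<in>U. X u \<omega>' \<in> B u} \<partial>P s x)"
  using assms
proof (induction U arbitrary: s t x G rule: finite_linorder_min_induct)
  case empty
  have "emeasure (P t y) {\<omega>'\<in>\<Omega>. \<forall>u\<in>{}. X u \<omega>' \<in> B u} = 1" for y
    using prob_space.emeasure_space_1[OF prob_space_P, of t y] empty by (simp add: space_P)
  moreover have "G \<in> sets (P s x)" using empty by (auto simp: sets_P intro: sets_past_future)
  ultimately show ?case using sets.sets_into_space[of G "past s t"] empty
    by (simp add: Int_absorb2)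
next
  case (insert b U)
  let ?C = "\<lambda>U. {\<omega>\<in>\<Omega>. \<forall>u\<in>U. X u \<omega> \<in> B u}"
  have b: "b \<in> I" "t \<le> b" "s \<le> b" and B: "B \<in> U \<rightarrow> sets \<E>" "B b \<in> sets \<E>" and U: "U \<subseteq> I \<inter> {b..}"
    using insert by auto
  have eC: "?C (insert b U) = (X b -` B b \<inter> \<Omega>) \<inter> ?C U" by auto
  have Bb: "X b -` B b \<inter> \<Omega> \<in> sets (past r b)" if "r \<le> b" for r
    using measurable_sets[OF measurable_X, of b "I \<inter> {r..b}"] b B that by auto
  let ?g = "\<lambda>y. emeasure (P b y) (?C U)"
  let ?f = "\<lambda>y. indicator (B b) y * ?g y :: ennreal"
  have "?g \<in> borel_measurable \<E>"
    using U by (intro measurable_compose[OF subprob_kernel measurable_emeasure_subprob_algebra] sets_cylinder b B insert)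
  then have f: "?f \<in> borel_measurable \<E>" using B by auto
  have inner: "(\<integral>\<^sup>+\<omega>'. ?f (X b \<omega>') \<partial>P t y) = emeasure (P t y) (?C (insert b U))" for y
  proof -
    have "(\<integral>\<^sup>+\<omega>'. ?f (X b \<omega>') \<partial>P t y) = (\<integral>\<^sup>+\<omega>'. indicator (X b -` B b \<inter> \<Omega>) \<omega>' * ?g (X b \<omega>') \<partial>P t y)"
      by (intro nn_integral_cong) (use insert.prems in \<open>auto simp: space_P split: split_indicator\<close>)
    also have "\<dots> = emeasure (P t y) ((X b -` B b \<inter> \<Omega>) \<inter> ?C U)"
      using insert.prems b by (intro insert.IH[symmetric] U B Bb) auto
    finally show ?thesis unfolding eC .
  qed
  have "emeasure (P s x) (G \<inter> ?C (insert b U)) = emeasure (P s x) ((G \<inter> (X b -` B b \<inter> \<Omega>)) \<inter> ?C U)"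
    unfolding eC by (simp add: Int_assoc)
  also have "\<dots> = (\<integral>\<^sup>+\<omega>. indicator (G \<inter> (X b -` B b \<inter> \<Omega>)) \<omega> * ?g (X b \<omega>) \<partial>P s x)"
    using insert.prems b by (intro insert.IH U B sets.Int Bb sets_past_mono[of s s t b G]) auto
  also have "\<dots> = (\<integral>\<^sup>+\<omega>. indicator G \<omega> * ?f (X b \<omega>) \<partial>P s x)"
    by (intro nn_integral_cong) (use insert.prems in \<open>auto simp: space_P split: split_indicator\<close>)
  also have "\<dots> = (\<integral>\<^sup>+\<omega>. indicator G \<omega> * (\<integral>\<^sup>+\<omega>'. ?f (X b \<omega>') \<partial>P t (X t \<omega>)) \<partial>P s x)"
    using insert.prems b f by (intro markov_nn_integral) auto
  finally show ?case by (simp only: inner)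
qed

section \<open>Functionals depending jointly on past and future\<close>

lemma sets_past_future_pair:
  fixes t :: real and M :: "'w measure"
  defines "C \<equiv> {{\<omega>\<in>\<Omega>. \<forall>u\<in>U. X u \<omega> \<in> B u} | U B. finite U \<and> U \<subseteq> I \<inter> {t..} \<and> B \<in> U \<rightarrow> sets \<E>}"
  shows "sets (M \<Otimes>\<^sub>M future t) = sigma_sets (space M \<times> \<Omega>) {a \<times> b | a b. a \<in> sets M \<and> b \<in> C}"
proof -
  have CP: "C \<subseteq> Pow \<Omega>" unfolding C_def by auto
  have fut: "sets (future t) = sigma_sets \<Omega> C"
  proof
    show "sets (future t) \<subseteq> sigma_sets \<Omega> C"
      unfolding sets_natural_sigma
    proof (rule sigma_sets_mono', safe)
      fix u B assume "u \<in> I" "t \<le> u" "B \<in> sets \<E>"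
      then show "X u -` B \<inter> \<Omega> \<in> C" unfolding C_def
        by (intro CollectI exI[of _ "{u}"] exI[of _ "\<lambda>_. B"]) auto
    qed
    have "C \<subseteq> sets (future t)"
      unfolding C_def using sets_cylinder by blast
    then show "sigma_sets \<Omega> C \<subseteq> sets (future t)"
      using sets.sigma_sets_subset[of C "future t"] by simp
  qed
  have "\<Omega> \<in> C" unfolding C_def by (intro CollectI exI[of _ "{}"]) auto
  then have "sets (M \<Otimes>\<^sub>M future t) = sets (sigma (space M \<times> space (future t)) {a \<times> b | a b. a \<in> sets M \<and> b \<in> C})"
    by (intro sets_pair_eq[where Ca = "{space M}" and Cb = "{\<Omega>}"])
      (auto simp: fut CP sets.space_closed sets.sigma_sets_eq intro: CP[THEN subsetD, THEN PowD])
  also have "\<dots> = sigma_sets (space M \<times> \<Omega>) {a \<times> b | a b. a \<in> sets M \<and> b \<in> C}"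
    using CP sets.space_closed[of M] by (subst sets_measure_of) (simp, blast, simp)
  finally show ?thesis .
qed

text \<open>The arguments of \<open>f\<close> stand for past and future. On the left both come from
  one \<open>\<omega>\<close>; on the right the future is resampled from
  \<open>P t (X t \<omega>)\<close>. As measures on the product of the two sigma-algebras, the image
  under the diagonal and the mixture of the \<open>?K\<close> are determined by rectangles of a past
  event and a future cylinder, where \<open>markov_cylinder\<close> applies.\<close>

lemma markov_pair:
  assumes st: "s \<in> I" "t \<in> I" "s \<le> t"
    and f: "case_prod f \<in> borel_measurable (past s t \<Otimes>\<^sub>M future t)"
  shows "(\<integral>\<^sup>+\<omega>. f \<omega> \<omega> \<partial>P s x) = (\<integral>\<^sup>+\<omega>. (\<integral>\<^sup>+\<omega>'. f \<omega> \<omega>' \<partial>P t (X t \<omega>)) \<partial>P s x)"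
proof -
  let ?R = "past s t \<Otimes>\<^sub>M future t"
  let ?K = "\<lambda>\<omega>. distr (P t (X t \<omega>)) ?R (Pair \<omega>)"
  have id: "(\<lambda>\<omega>. \<omega>) \<in> P s x \<rightarrow>\<^sub>M past s t" "(\<lambda>\<omega>. \<omega>) \<in> P s x \<rightarrow>\<^sub>M future t"
    using st by (auto intro!: measurable_P measurable_ident_natural_sigma)
  have dm: "(\<lambda>\<omega>. (\<omega>, \<omega>)) \<in> P s x \<rightarrow>\<^sub>M ?R" using id by (rule measurable_Pair)
  have Xt: "X t \<in> P s x \<rightarrow>\<^sub>M \<E>" using st by (intro measurable_P measurable_X) auto
  have K: "?K \<in> P s x \<rightarrow>\<^sub>M subprob_algebra ?R"
  proof (rule measurable_distr2[where M = "future t"])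
    show "(\<lambda>\<omega>. P t (X t \<omega>)) \<in> P s x \<rightarrow>\<^sub>M subprob_algebra (future t)"
      by (rule measurable_compose[OF Xt subprob_kernel]) fact
    show "(\<lambda>(\<omega>, y). (\<omega>, y)) \<in> P s x \<Otimes>\<^sub>M future t \<rightarrow>\<^sub>M ?R"
      unfolding split_beta' by (rule measurable_Pair[OF measurable_compose[OF measurable_fst id(1)] measurable_snd])
  qed
  have ne: "space (P s x) \<noteq> {}" using prob_space.not_empty[OF prob_space_P, of s x] st by simp
  have PtR: "Pair \<omega> \<in> P t y \<rightarrow>\<^sub>M ?R" if "\<omega> \<in> \<Omega>" for \<omega> y
    using st that by (intro measurable_P measurable_Pair1') auto
  define C where "C = {{\<omega>\<in>\<Omega>. \<forall>u\<in>U. X u \<omega> \<in> B u} | U B. finite U \<and> U \<subseteq> I \<inter> {t..} \<and> B \<in> U \<rightarrow> sets \<E>}"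
  let ?S = "{a \<times> b | a b. a \<in> sets (past s t) \<and> b \<in> C}"
  have C_int: "b \<inter> b' \<in> C" if b: "b \<in> C" "b' \<in> C" for b b'
  proof -
    from b[unfolded C_def] obtain U B U' B' where U: "finite U" "U \<subseteq> I \<inter> {t..}" "B \<in> U \<rightarrow> sets \<E>"
        "finite U'" "U' \<subseteq> I \<inter> {t..}" "B' \<in> U' \<rightarrow> sets \<E>"
      and e: "b = {\<omega>\<in>\<Omega>. \<forall>u\<in>U. X u \<omega> \<in> B u}" "b' = {\<omega>\<in>\<Omega>. \<forall>u\<in>U'. X u \<omega> \<in> B' u}"
      by blast
    \<comment> \<open>A time constrained by only one of the two cylinders gets the whole space as
      its other constraint.\<close>
    let ?B = "\<lambda>u. (if u \<in> U then B u else UNIV) \<inter> (if u \<in> U' then B' u else UNIV)"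
    have "?B u \<in> sets \<E>" if "u \<in> U \<union> U'" for u
      using U that sets.top[of \<E>] by (auto simp: space_state)
    then show ?thesis using U unfolding e C_def
      by (intro CollectI exI[of _ "U \<union> U'"] exI[of _ ?B]) auto
  qed
  have C_sets: "b \<in> sets (future t)" if "b \<in> C" for b
    using that[unfolded C_def] sets_cylinder[where J = "I \<inter> {t..}"] by blast
  have eq: "distr (P s x) ?R (\<lambda>\<omega>. (\<omega>, \<omega>)) = P s x \<bind> ?K"
  proof (rule measure_eqI_generator_eq[where E = ?S and \<Omega> = "\<Omega> \<times> \<Omega>" and A = "\<lambda>_. \<Omega> \<times> \<Omega>"])
    show "Int_stable ?S"
    proof (rule Int_stableI)
      fix p q assume "p \<in> ?S" "q \<in> ?S"
      then obtain a b a' b' where "p = a \<times> b" "q = a' \<times> b'" "a \<in> sets (past s t)" "a' \<in> sets (past s t)" "b \<in> C" "b' \<in> C"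
        by auto
      moreover then have "p \<inter> q = (a \<inter> a') \<times> (b \<inter> b')" "a \<inter> a' \<in> sets (past s t)" "b \<inter> b' \<in> C"
        using C_int[of b b'] by auto
      ultimately show "p \<inter> q \<in> ?S" by blast
    qed
    show "?S \<subseteq> Pow (\<Omega> \<times> \<Omega>)"
      using sets.sets_into_space[of _ "past s t"] sets.sets_into_space[OF C_sets] by auto
    have sR: "sets ?R = sigma_sets (\<Omega> \<times> \<Omega>) ?S"
      using sets_past_future_pair[of "past s t" t] by (simp add: C_def)
    then show "sets (distr (P s x) ?R (\<lambda>\<omega>. (\<omega>, \<omega>))) = sigma_sets (\<Omega> \<times> \<Omega>) ?S" by simp
    show "sets (P s x \<bind> ?K) = sigma_sets (\<Omega> \<times> \<Omega>) ?S"
      using sets_bind_measurable[OF K ne] sR by simp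
    have "\<Omega> \<in> C" unfolding C_def by (intro CollectI exI[of _ "{}"]) auto
    moreover have "\<Omega> \<in> sets (past s t)" using sets.top[of "past s t"] by simp
    ultimately show "range (\<lambda>_. \<Omega> \<times> \<Omega>) \<subseteq> ?S" by blast
    show "(\<Union>i::nat. \<Omega> \<times> \<Omega>) = \<Omega> \<times> \<Omega>" by simp
    interpret D: prob_space "distr (P s x) ?R (\<lambda>\<omega>. (\<omega>, \<omega>))"
      using st dm by (intro prob_space.prob_space_distr prob_space_P)
    show "emeasure (distr (P s x) ?R (\<lambda>\<omega>. (\<omega>, \<omega>))) (\<Omega> \<times> \<Omega>) \<noteq> \<infinity>" by simp
    fix p assume p: "p \<in> ?S"
    then obtain G b where G: "p = G \<times> b" "G \<in> sets (past s t)" "b \<in> C" by auto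
    from G(3)[unfolded C_def] obtain U B where b: "b = {\<omega>\<in>\<Omega>. \<forall>u\<in>U. X u \<omega> \<in> B u}" "finite U" "U \<subseteq> I \<inter> {t..}" "B \<in> U \<rightarrow> sets \<E>"
      by auto
    have pR: "p \<in> sets ?R" using G C_sets by auto
    have "emeasure (distr (P s x) ?R (\<lambda>\<omega>. (\<omega>, \<omega>))) p = emeasure (P s x) (G \<inter> b)"
      using sets.sets_into_space[OF G(2)]
      by (subst emeasure_distr[OF dm pR]) (auto simp: G space_P st intro!: arg_cong[where f = "emeasure (P s x)"])
    also have "\<dots> = (\<integral>\<^sup>+\<omega>. indicator G \<omega> * emeasure (P t (X t \<omega>)) b \<partial>P s x)"
      unfolding b(1) using b G st by (intro markov_cylinder) auto
    also have "\<dots> = (\<integral>\<^sup>+\<omega>. emeasure (?K \<omega>) p \<partial>P s x)"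
    proof (rule nn_integral_cong)
      fix \<omega> assume "\<omega> \<in> space (P s x)"
      then have w: "\<omega> \<in> \<Omega>" using st by (simp add: space_P)
      have "Pair \<omega> -` p \<inter> space (P t (X t \<omega>)) = (if \<omega> \<in> G then b else {})"
        using b(1) st by (auto simp: G space_P)
      then show "indicator G \<omega> * emeasure (P t (X t \<omega>)) b = emeasure (?K \<omega>) p"
        using emeasure_distr[OF PtR[OF w, of "X t \<omega>"] pR] by simp
    qed
    also have "\<dots> = emeasure (P s x \<bind> ?K) p"
      by (rule emeasure_bind[OF ne K pR, symmetric])
    finally show "emeasure (distr (P s x) ?R (\<lambda>\<omega>. (\<omega>, \<omega>))) p = emeasure (P s x \<bind> ?K) p" .
  qed
  have "(\<integral>\<^sup>+\<omega>. f \<omega> \<omega> \<partial>P s x) = (\<integral>\<^sup>+p. case_prod f p \<partial>distr (P s x) ?R (\<lambda>\<omega>. (\<omega>, \<omega>)))"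
    using f by (subst nn_integral_distr[OF dm]) auto
  also have "\<dots> = (\<integral>\<^sup>+\<omega>. (\<integral>\<^sup>+p. case_prod f p \<partial>?K \<omega>) \<partial>P s x)"
    unfolding eq by (rule nn_integral_bind[OF f K])
  also have "\<dots> = (\<integral>\<^sup>+\<omega>. (\<integral>\<^sup>+\<omega>'. f \<omega> \<omega>' \<partial>P t (X t \<omega>)) \<partial>P s x)"
    using st f by (intro nn_integral_cong) (subst nn_integral_distr[OF PtR], auto simp: space_P)
  finally show ?thesis .
qed

end

section \<open>Survival and the killed semigroup\<close>

context absorbed_markov_process
begin

definition surv :: "real \<Rightarrow> real \<Rightarrow> 'w set" where
  "surv s t = {\<omega>\<in>\<Omega>. hitting_time I X A s \<omega> > ereal t}"

definition S :: "real \<Rightarrow> real \<Rightarrow> 'e \<Rightarrow> real" where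
  "S s t x = measure (P s x) (surv s t)"

text \<open>The semigroup of the process killed at absorption, acting on functions with values in
  \<open>ennreal\<close>; at the constant 1 it gives \<open>S s t\<close>.\<close>

definition W :: "real \<Rightarrow> real \<Rightarrow> ('e \<Rightarrow> ennreal) \<Rightarrow> 'e \<Rightarrow> ennreal" where
  "W s t w x = (\<integral>\<^sup>+\<omega>. indicator (surv s t) \<omega> * w (X t \<omega>) \<partial>P s x)"

lemma sets_surv:
  assumes "s \<in> I" "t \<in> I" "s \<le> t"
  shows "surv s t \<in> sets (past s t)"
proof -
  have "{\<omega>\<in>space (past s t). \<not> hitting_time I X A s \<omega> \<le> ereal t} \<in> sets (past s t)"
    using absorption_stopping_time[OF assms] by measurable
  then show ?thesis by (simp add: surv_def not_le)
qed

lemma sets_surv_future: "s \<in> I \<Longrightarrow> t \<in> I \<Longrightarrow> s \<le> t \<Longrightarrow> surv s t \<in> sets (future s)"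
  by (rule sets_past_future[OF order_refl sets_surv])

text \<open>The absorption times counted from \<open>s\<close> and from \<open>t\<close> differ only
  through entries before \<open>t\<close>. If the first exceeds \<open>t\<close>, every absorbing
  entry occurs after \<open>t\<close>, and the two infima run over the same set.\<close>

lemma surv_split:
  assumes "s \<in> I" "t \<in> I" "T \<in> I" "s \<le> t" "t \<le> T"
  shows "surv s T = surv s t \<inter> surv t T"
proof -
  let ?H = "\<lambda>s \<omega>. {ereal r | r. r \<in> I \<and> s \<le> r \<and> X r \<omega> \<in> A r}"
  have 1: "hitting_time I X A s \<omega> \<le> hitting_time I X A t \<omega>" for \<omega>
    unfolding hitting_time_def by (rule Inf_superset_mono) (use assms in auto)
  have 2: "hitting_time I X A s \<omega> = hitting_time I X A t \<omega>" if "ereal t < hitting_time I X A s \<omega>" for \<omega>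
  proof -
    have "t \<le> r" if "r \<in> I" "s \<le> r" "X r \<omega> \<in> A r" for r
    proof -
      have "hitting_time I X A s \<omega> \<le> ereal r"
        unfolding hitting_time_def by (rule Inf_lower) (use that in auto)
      with \<open>ereal t < _\<close> have "ereal t < ereal r" by (rule less_le_trans)
      then show ?thesis by simp
    qed
    then have "?H s \<omega> = ?H t \<omega>" using assms by auto
    then show ?thesis by (simp add: hitting_time_def)
  qed
  have 3: "ereal t < hitting_time I X A s \<omega>" if "ereal T < hitting_time I X A s \<omega>" for \<omega>
    using assms(5) that by (intro le_less_trans[of "ereal t" "ereal T"]) auto
  show ?thesis
    unfolding surv_def using 2 3 less_le_trans[OF _ 1] by auto
qed

text \<open>An entry at time \<open>t\<close> itself would belong to the set whose infimum has to
  exceed \<open>t\<close>. Because of this, functions of \<open>X t\<close> matter only off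
  \<open>A t\<close> on survival; \<open>H\<close>, for instance, is controlled only there.\<close>

lemma surv_not_absorbed: "t \<in> I \<Longrightarrow> s \<le> t \<Longrightarrow> \<omega> \<in> surv s t \<Longrightarrow> X t \<omega> \<notin> A t"
proof
  assume *: "t \<in> I" "s \<le> t" "\<omega> \<in> surv s t" "X t \<omega> \<in> A t"
  then have "hitting_time I X A s \<omega> \<le> ereal t"
    unfolding hitting_time_def by (intro Inf_lower) auto
  with * show False by (auto simp: surv_def)
qed

text \<open>Survival from \<open>s\<close> to \<open>T\<close> factors by \<open>surv_split\<close>,
  so \<open>markov_pair\<close> applies to the product. The weight \<open>g\<close> may look at the
  past in one argument and at the trajectory on [t,T] in the other; this generality is used when
  segments of the \<open>Q\<close>-process are joined.\<close>

lemma W_pair: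
  assumes st: "s \<in> I" "t \<in> I" "T \<in> I" "s \<le> t" "t \<le> T" and w: "w \<in> borel_measurable \<E>"
    and g: "case_prod g \<in> borel_measurable (past s t \<Otimes>\<^sub>M past t T)"
  shows "(\<integral>\<^sup>+\<omega>. indicator (surv s t) \<omega> * (\<integral>\<^sup>+\<omega>'. g \<omega> \<omega>' * (indicator (surv t T) \<omega>' * w (X T \<omega>')) \<partial>P t (X t \<omega>)) \<partial>P s x) =
    (\<integral>\<^sup>+\<omega>. g \<omega> \<omega> * (indicator (surv s T) \<omega> * w (X T \<omega>)) \<partial>P s x)"
proof -
  let ?f = "\<lambda>\<omega> \<omega>'. g \<omega> \<omega>' * (indicator (surv s t) \<omega> * (indicator (surv t T) \<omega>' * w (X T \<omega>')))"
  let ?R = "past s t \<Otimes>\<^sub>M future t"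
  have fut: "(\<lambda>\<omega>. \<omega>) \<in> future t \<rightarrow>\<^sub>M past t T" by (rule measurable_ident_natural_sigma) auto
  have [measurable]: "(\<lambda>p. g (fst p) (snd p)) \<in> borel_measurable ?R"
    using measurable_compose[OF measurable_Pair[OF measurable_fst measurable_compose[OF measurable_snd fut]] g]
    by simp
  have [measurable]: "surv s t \<in> sets (past s t)" "surv t T \<in> sets (future t)" "X T \<in> future t \<rightarrow>\<^sub>M \<E>"
    using st sets_surv sets_surv_future by (auto intro!: measurable_X)
  note [measurable] = w
  have f: "case_prod ?f \<in> borel_measurable ?R"
    unfolding split_beta' by measurable
  have "(\<integral>\<^sup>+\<omega>. g \<omega> \<omega> * (indicator (surv s T) \<omega> * w (X T \<omega>)) \<partial>P s x) = (\<integral>\<^sup>+\<omega>. ?f \<omega> \<omega> \<partial>P s x)"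
    by (intro nn_integral_cong) (auto simp: surv_split[OF st] split: split_indicator)
  also have "\<dots> = (\<integral>\<^sup>+\<omega>. (\<integral>\<^sup>+\<omega>'. ?f \<omega> \<omega>' \<partial>P t (X t \<omega>)) \<partial>P s x)"
    by (rule markov_pair) fact+
  also have "\<dots> = (\<integral>\<^sup>+\<omega>. indicator (surv s t) \<omega> * (\<integral>\<^sup>+\<omega>'. g \<omega> \<omega>' * (indicator (surv t T) \<omega>' * w (X T \<omega>')) \<partial>P t (X t \<omega>)) \<partial>P s x)"
    by (intro nn_integral_cong) (auto split: split_indicator)
  finally show ?thesis ..
qed

text \<open>For a weight that depends on the past alone the inner integral of \<open>W_pair\<close>
  becomes \<open>W t T w\<close>. This yields the Chapman-Kolmogorov equation \<open>W_W\<close>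
  and, later, the weights of the conditioned path laws.\<close>

lemma W_weight:
  assumes st: "s \<in> I" "t \<in> I" "T \<in> I" "s \<le> t" "t \<le> T" and w: "w \<in> borel_measurable \<E>"
    and g: "g \<in> borel_measurable (past s t)"
  shows "(\<integral>\<^sup>+\<omega>. g \<omega> * (indicator (surv s t) \<omega> * W t T w (X t \<omega>)) \<partial>P s x) =
    (\<integral>\<^sup>+\<omega>. g \<omega> * (indicator (surv s T) \<omega> * w (X T \<omega>)) \<partial>P s x)"
proof -
  have m: "(\<lambda>\<omega>'. indicator (surv t T) \<omega>' * w (X T \<omega>')) \<in> borel_measurable (P t y)" for y
    using st sets_surv_future[of t T] measurable_compose[OF measurable_X[of T] w] by (intro measurable_P) auto
  have "(\<integral>\<^sup>+\<omega>. g \<omega> * (indicator (surv s t) \<omega> * W t T w (X t \<omega>)) \<partial>P s x) =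
    (\<integral>\<^sup>+\<omega>. indicator (surv s t) \<omega> * (\<integral>\<^sup>+\<omega>'. g \<omega> * (indicator (surv t T) \<omega>' * w (X T \<omega>')) \<partial>P t (X t \<omega>)) \<partial>P s x)"
    unfolding W_def using m by (intro nn_integral_cong) (auto simp: nn_integral_cmult split: split_indicator)
  also have "\<dots> = (\<integral>\<^sup>+\<omega>. g \<omega> * (indicator (surv s T) \<omega> * w (X T \<omega>)) \<partial>P s x)"
    by (rule W_pair[OF st w, of "\<lambda>\<omega> _. g \<omega>"]) (use measurable_compose[OF measurable_fst g] in \<open>simp add: split_beta'\<close>)
  finally show ?thesis .
qed

lemma W_W:
  assumes "s \<in> I" "t \<in> I" "T \<in> I" "s \<le> t" "t \<le> T" "w \<in> borel_measurable \<E>"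
  shows "W s t (W t T w) x = W s T w x"
  unfolding W_def[of s] using W_weight[OF assms, of "\<lambda>_. 1"] by simp

lemma W_one: "s \<in> I \<Longrightarrow> t \<in> I \<Longrightarrow> s \<le> t \<Longrightarrow> W s t (\<lambda>_. 1) x = ennreal (S s t x)"
  using finite_measure.emeasure_eq_measure[OF prob_space.finite_measure[OF prob_space_P]] sets_surv_future[of s t]
  by (simp add: W_def S_def sets_P)

lemma W_cong:
  assumes "t \<in> I" "s \<le> t" "\<And>y. y \<notin> A t \<Longrightarrow> w y = w' y"
  shows "W s t w x = W s t w' x"
  unfolding W_def
  by (intro nn_integral_cong) (use assms surv_not_absorbed in \<open>auto split: split_indicator\<close>)

lemma S_measurable [measurable (raw)]: "s \<in> I \<Longrightarrow> t \<in> I \<Longrightarrow> s \<le> t \<Longrightarrow> S s t \<in> borel_measurable \<E>"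
  unfolding S_def by (rule measurable_compose[OF kernel measurable_measure_prob_algebra[OF sets_surv_future]])

lemma S_nonneg: "0 \<le> S s t x"
  by (simp add: S_def)

lemma S_le_1: "s \<in> I \<Longrightarrow> S s t x \<le> 1"
  unfolding S_def by (rule prob_space.prob_le_1[OF prob_space_P])

lemma S_pos: "s \<in> I \<Longrightarrow> t \<in> I \<Longrightarrow> s \<le> t \<Longrightarrow> x \<notin> A s \<Longrightarrow> 0 < S s t x"
  using survival_pos[of s t x] by (simp add: S_def surv_def space_P)

text \<open>The sub-Markov kernel behind \<open>W\<close>, kept as a measure so that signed
  combinations of survival probabilities can be integrated as real functions.\<close>

definition \<kappa> :: "real \<Rightarrow> real \<Rightarrow> 'e \<Rightarrow> 'e measure" where
  "\<kappa> s t x = distr (density (P s x) (indicator (surv s t))) \<E> (X t)"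

lemma sets_kappa [simp, measurable_cong]: "sets (\<kappa> s t x) = sets \<E>"
  and space_kappa [simp]: "space (\<kappa> s t x) = UNIV"
  by (simp_all add: \<kappa>_def space_state)

lemma nn_integral_kappa:
  assumes "s \<in> I" "t \<in> I" "s \<le> t" "w \<in> borel_measurable \<E>"
  shows "(\<integral>\<^sup>+y. w y \<partial>\<kappa> s t x) = W s t w x"
proof -
  have X: "X t \<in> P s x \<rightarrow>\<^sub>M \<E>" and s: "surv s t \<in> sets (P s x)"
    using assms sets_surv_future by (auto intro!: measurable_P measurable_X simp: sets_P)
  show ?thesis
    unfolding \<kappa>_def W_def
    using X s assms(4) measurable_compose[OF X assms(4)] by (simp add: nn_integral_distr nn_integral_density)
qed

lemma emeasure_kappa:
  assumes "s \<in> I" "t \<in> I" "s \<le> t" "B \<in> sets \<E>"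
  shows "emeasure (\<kappa> s t x) B = emeasure (P s x) {\<omega>\<in>surv s t. X t \<omega> \<in> B}"
proof -
  have "X t -` B \<inter> space (future s) \<in> sets (future s)"
    using assms by (intro measurable_sets[OF measurable_X]) auto
  from sets.Int[OF this sets_surv_future[of s t]] have m: "{\<omega>\<in>surv s t. X t \<omega> \<in> B} \<in> sets (P s x)"
    using assms by (simp add: sets_P surv_def vimage_def Int_def conj_ac)
  have "emeasure (\<kappa> s t x) B = W s t (indicator B) x"
    using nn_integral_kappa[OF assms(1-3), of "indicator B"] assms(4) by simp
  also have "\<dots> = (\<integral>\<^sup>+\<omega>. indicator {\<omega>\<in>surv s t. X t \<omega> \<in> B} \<omega> \<partial>P s x)"
    unfolding W_def by (intro nn_integral_cong) (auto split: split_indicator)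
  finally show ?thesis using m by simp
qed

lemma emeasure_kappa_UNIV:
  assumes "s \<in> I" "t \<in> I" "s \<le> t"
  shows "emeasure (\<kappa> s t x) UNIV = ennreal (S s t x)"
  using nn_integral_kappa[OF assms, of "\<lambda>_. 1"] W_one[OF assms] by simp

lemma finite_measure_kappa:
  assumes "s \<in> I" "t \<in> I" "s \<le> t"
  shows "finite_measure (\<kappa> s t x)"
  by (rule finite_measureI) (simp add: emeasure_kappa_UNIV[OF assms])

lemma AE_kappa:
  assumes "s \<in> I" "t \<in> I" "s \<le> t"
  shows "AE y in \<kappa> s t x. y \<notin> A t"
proof (rule AE_I[where N = "A t"])
  show "A t \<in> sets (\<kappa> s t x)" using absorbing_sets[OF assms(2)] by simp
  show "emeasure (\<kappa> s t x) (A t) = 0"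
    unfolding emeasure_kappa[OF assms absorbing_sets[OF assms(2)]]
    using surv_not_absorbed[OF assms(2,3)] by (auto simp: Collect_empty_eq[THEN iffD2])
qed auto

lemma integrable_kappa:
  assumes "s \<in> I" "t \<in> I" "s \<le> t" "f \<in> borel_measurable \<E>" "\<And>y. y \<notin> A t \<Longrightarrow> \<bar>f y\<bar> \<le> c"
  shows "integrable (\<kappa> s t x) (f :: 'e \<Rightarrow> real)"
proof -
  interpret finite_measure "\<kappa> s t x" by (rule finite_measure_kappa) fact+
  show ?thesis
    by (rule integrable_const_bound[of _ c])
      (use AE_kappa[OF assms(1-3), of x] assms(4,5) in \<open>auto simp: measurable_cong_sets[OF sets_kappa]\<close>)
qed

lemma integrable_S_kappa:
  assumes "s \<in> I" "t \<in> I" "s \<le> t" "T \<in> I" "t \<le> T"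
  shows "integrable (\<kappa> s t x) (S t T)"
  by (rule integrable_kappa[of _ _ _ 1]) (use assms in \<open>auto simp: S_nonneg S_le_1 S_measurable\<close>)

text \<open>\<open>W_W\<close> at the constant function 1, read as a real integral. Every comparison
  of survival probabilities from two different starting times goes through this identity.\<close>

lemma S_kappa:
  assumes "s \<in> I" "t \<in> I" "T \<in> I" "s \<le> t" "t \<le> T"
  shows "(\<integral>y. S t T y \<partial>\<kappa> s t x) = S s T x"
proof -
  have "ennreal (\<integral>y. S t T y \<partial>\<kappa> s t x) = (\<integral>\<^sup>+y. S t T y \<partial>\<kappa> s t x)"
    using assms by (intro nn_integral_eq_integral[symmetric] integrable_S_kappa) (auto simp: S_nonneg)
  also have "\<dots> = W s t (W t T (\<lambda>_. 1)) x"
    using assms by (subst nn_integral_kappa) (auto simp: S_measurable W_one cong: W_cong)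
  also have "\<dots> = ennreal (S s T x)"
    using assms by (simp add: W_W W_one)
  finally show ?thesis by (simp add: S_nonneg)
qed

lemma measure_kappa: "s \<in> I \<Longrightarrow> t \<in> I \<Longrightarrow> s \<le> t \<Longrightarrow> measure (\<kappa> s t x) UNIV = S s t x"
  using emeasure_kappa_UNIV[of s t x] by (simp add: measure_def S_nonneg)

end

section \<open>Contraction of ratios of survival probabilities\<close>

locale doeblin_absorbed_process = absorbed_markov_process I \<Omega> \<E> X P A
  for I :: "real set" and \<Omega> :: "'w set" and \<E> :: "('e::metric_space) measure"
    and X :: "real \<Rightarrow> 'w \<Rightarrow> 'e" and P :: "real \<Rightarrow> 'e \<Rightarrow> 'w measure" and A :: "real \<Rightarrow> 'e set" +
  fixes \<nu> :: "real \<Rightarrow> 'e measure" and t0 c1 c2 :: real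
  assumes nu: "s \<in> I \<Longrightarrow> \<nu> s \<in> prob_measures_on \<E> (- A s)"
    and t0: "t0 \<in> I" "t0 > 0"
    and c1: "c1 > 0"
    and c2: "c2 > 0"
    and A'1: "\<lbrakk>s \<in> I; x \<in> - A s; B \<in> sets \<E>\<rbrakk> \<Longrightarrow>
      \<P>(\<omega> in P s x. X (s + t0) \<omega> \<in> B \<bar> hitting_time I X A s \<omega> > ereal (s + t0))
        \<ge> c1 * measure (\<nu> (s + t0)) B"
    and A'2: "\<lbrakk>s \<in> I; t \<in> I; s \<le> t; x \<in> - A s\<rbrakk> \<Longrightarrow>
      \<P>(\<omega> in \<nu> s \<bind> P s. hitting_time I X A s \<omega> > ereal t)
        \<ge> c2 * \<P>(\<omega> in P s x. hitting_time I X A s \<omega> > ereal t)"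
begin

text \<open>Survival probability when the process starts from \<open>\<nu> s\<close> at time
  \<open>s\<close>, the left-hand side of (A'2).\<close>

definition N :: "real \<Rightarrow> real \<Rightarrow> real" where
  "N s t = (\<integral>y. S s t y \<partial>\<nu> s)"

lemma prob_space_nu: "s \<in> I \<Longrightarrow> prob_space (\<nu> s)"
  and sets_nu: "s \<in> I \<Longrightarrow> sets (\<nu> s) = sets \<E>"
  and nu_prob_algebra: "s \<in> I \<Longrightarrow> \<nu> s \<in> space (prob_algebra \<E>)"
  using nu[of s] by (auto simp: prob_measures_on_def space_prob_algebra)

lemma AE_nu:
  assumes "s \<in> I"
  shows "AE y in \<nu> s. y \<notin> A s"
proof -
  interpret prob_space "\<nu> s" by (rule prob_space_nu) fact
  have "prob (- A s) = 1" using nu[OF assms] by (simp add: prob_measures_on_def)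
  then show ?thesis using AE_prob_1[of "- A s"] by simp
qed

lemma integrable_nu:
  assumes "s \<in> I" "f \<in> borel_measurable \<E>" "\<And>y. y \<notin> A s \<Longrightarrow> \<bar>f y\<bar> \<le> c"
  shows "integrable (\<nu> s) (f :: 'e \<Rightarrow> real)"
proof -
  interpret prob_space "\<nu> s" by (rule prob_space_nu) fact
  show ?thesis
    by (rule integrable_const_bound[of _ c])
      (use AE_nu[OF assms(1)] assms in \<open>auto simp: measurable_cong_sets[OF sets_nu]\<close>)
qed

lemma integrable_S_nu: "s \<in> I \<Longrightarrow> t \<in> I \<Longrightarrow> s \<le> t \<Longrightarrow> integrable (\<nu> s) (S s t)"
  by (rule integrable_nu[of _ _ 1]) (auto simp: S_nonneg S_le_1 S_measurable)

text \<open>This is (A'2): survival under the mixture of the laws \<open>P s y\<close> has as its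
  probability the \<open>\<nu> s\<close>-average of the \<open>S s t y\<close>.\<close>

lemma S_le_N:
  assumes "s \<in> I" "t \<in> I" "s \<le> t" "x \<notin> A s"
  shows "c2 * S s t x \<le> N s t"
proof -
  have nonempty: "space (\<nu> s) \<noteq> {}"
    using prob_space.not_empty[OF prob_space_nu] assms by auto
  have sp: "space (\<nu> s \<bind> P s) = \<Omega>"
    using sets_eq_imp_space_eq[OF sets_bind'[OF nu_prob_algebra kernel]] assms by simp
  interpret B: prob_space "\<nu> s \<bind> P s"
    by (rule prob_space_bind'[OF nu_prob_algebra kernel]) (use assms in auto)
  have "ennreal (measure (\<nu> s \<bind> P s) (surv s t)) = emeasure (\<nu> s \<bind> P s) (surv s t)"
    by (simp add: B.emeasure_eq_measure)
  also have "\<dots> = (\<integral>\<^sup>+y. emeasure (P s y) (surv s t) \<partial>\<nu> s)"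
    by (rule emeasure_bind_prob_algebra[OF nu_prob_algebra kernel sets_surv_future]) (use assms in auto)
  also have "\<dots> = (\<integral>\<^sup>+y. ennreal (S s t y) \<partial>\<nu> s)"
    using finite_measure.emeasure_eq_measure[OF prob_space.finite_measure[OF prob_space_P]] assms
    by (simp add: S_def)
  also have "\<dots> = ennreal (N s t)"
    unfolding N_def using assms by (intro nn_integral_eq_integral integrable_S_nu) (auto simp: S_nonneg)
  finally have "measure (\<nu> s \<bind> P s) (surv s t) = N s t"
    by (simp add: N_def S_nonneg)
  then show ?thesis
    using A'2[of s t x] assms by (simp add: S_def surv_def space_P sp)
qed

lemma nu_not_absorbed:
  assumes "s \<in> I"
  obtains y where "y \<notin> A s"
proof -
  interpret prob_space "\<nu> s" by (rule prob_space_nu) fact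
  have "\<exists>y. y \<notin> A s"
  proof (rule ccontr)
    assume "\<nexists>y. y \<notin> A s"
    then have "AE y in \<nu> s. False" using AE_nu[OF assms] by simp
    then show False by simp
  qed
  with that show ?thesis by blast
qed

lemma N_pos:
  assumes "s \<in> I" "t \<in> I" "s \<le> t"
  shows "0 < N s t"
proof -
  obtain y where "y \<notin> A s" using nu_not_absorbed[OF assms(1)] .
  then have "0 < c2 * S s t y" using S_pos[OF assms] c2 by simp
  also have "\<dots> \<le> N s t" using S_le_N[OF assms] \<open>y \<notin> A s\<close> .
  finally show ?thesis .
qed

lemma doeblin_set:
  assumes "s \<in> I" "x \<notin> A s" "B \<in> sets \<E>"
  shows "c1 * S s (s + t0) x * measure (\<nu> (s + t0)) B \<le> measure (\<kappa> s (s + t0) x) B"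
proof -
  have st: "s + t0 \<in> I" "s \<le> s + t0" using assms t0 time_add by auto
  have pos: "0 < S s (s + t0) x" using assms st by (intro S_pos) auto
  have "c1 * measure (\<nu> (s + t0)) B \<le> measure (P s x) {\<omega>\<in>surv s (s + t0). X (s + t0) \<omega> \<in> B} / S s (s + t0) x"
    using A'1[of s x B] assms by (simp add: cond_prob_def S_def surv_def space_P conj_ac)
  also have "measure (P s x) {\<omega>\<in>surv s (s + t0). X (s + t0) \<omega> \<in> B} = measure (\<kappa> s (s + t0) x) B"
    unfolding measure_def using emeasure_kappa[of s "s + t0" B x] assms st by simp
  finally show ?thesis using pos by (simp add: field_simps)
qed

text \<open>The setwise domination of \<open>doeblin_set\<close> is one of measures, hence of
  integrals of nonnegative functions. Sign and bound are requested only off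
  \<open>A (s + t0)\<close>, a null set for both measures; the bound \<open>c\<close> provides
  integrability.\<close>

lemma doeblin:
  assumes s: "s \<in> I" "x \<notin> A s" and f: "f \<in> borel_measurable \<E>"
    and f0: "\<And>y. y \<notin> A (s + t0) \<Longrightarrow> 0 \<le> f y" and fc: "\<And>y. y \<notin> A (s + t0) \<Longrightarrow> f y \<le> c"
  shows "c1 * S s (s + t0) x * (\<integral>y. f y \<partial>\<nu> (s + t0)) \<le> (\<integral>y. f y \<partial>\<kappa> s (s + t0) x)"
proof -
  let ?v = "s + t0"
  have st: "?v \<in> I" "s \<le> ?v" using assms t0 time_add by auto
  let ?r = "ennreal (c1 * S s ?v x)"
  interpret nu: prob_space "\<nu> ?v" by (rule prob_space_nu) fact
  interpret ka: finite_measure "\<kappa> s ?v x" by (rule finite_measure_kappa) fact+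
  have [measurable_cong]: "sets (\<nu> ?v) = sets \<E>" by (rule sets_nu) fact
  note [measurable] = f
  have "scale_measure ?r (\<nu> ?v) \<le> \<kappa> s ?v x"
  proof (rule le_measure[THEN iffD2, OF _ ballI])
    fix B assume "B \<in> sets (scale_measure ?r (\<nu> ?v))"
    then have "B \<in> sets \<E>" by (simp add: sets_nu st)
    from doeblin_set[OF s this]
    show "emeasure (scale_measure ?r (\<nu> ?v)) B \<le> emeasure (\<kappa> s ?v x) B"
      using c1 S_nonneg[of s ?v x]
      by (simp add: nu.emeasure_eq_measure ka.emeasure_eq_measure ennreal_mult'[symmetric] ennreal_leI)
  qed (simp add: sets_nu st)
  then have "(\<integral>\<^sup>+y. f y \<partial>scale_measure ?r (\<nu> ?v)) \<le> (\<integral>\<^sup>+y. f y \<partial>\<kappa> s ?v x)"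
    by (intro nn_integral_mono_measure) (auto simp: sets_nu st)
  then have "?r * (\<integral>\<^sup>+y. f y \<partial>\<nu> ?v) \<le> (\<integral>\<^sup>+y. f y \<partial>\<kappa> s ?v x)"
    by (subst (asm) nn_integral_scale_measure) auto
  also have "(\<integral>\<^sup>+y. f y \<partial>\<kappa> s ?v x) = ennreal (\<integral>y. f y \<partial>\<kappa> s ?v x)"
    using AE_kappa[of s ?v x] s(1) st f0 fc
    by (intro nn_integral_eq_integral integrable_kappa[of _ _ _ c] f) (auto simp: abs_le_iff order_trans[of _ 0])
  also have "(\<integral>\<^sup>+y. f y \<partial>\<nu> ?v) = ennreal (\<integral>y. f y \<partial>\<nu> ?v)"
    using AE_nu[of ?v] st f0 fc
    by (intro nn_integral_eq_integral integrable_nu[of _ _ c] f) (auto simp: abs_le_iff order_trans[of _ 0])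
  finally have "ennreal (c1 * S s ?v x * (\<integral>y. f y \<partial>\<nu> ?v)) \<le> ennreal (\<integral>y. f y \<partial>\<kappa> s ?v x)"
    using c1 S_nonneg[of s ?v x] by (simp add: ennreal_mult')
  moreover have "0 \<le> (\<integral>y. f y \<partial>\<kappa> s ?v x)"
    using AE_kappa[of s ?v x] s(1) st f0 by (intro integral_nonneg_AE) auto
  ultimately show ?thesis by simp
qed

abbreviation \<gamma> :: real where "\<gamma> \<equiv> c1 * c2"

text \<open>Take the whole space as \<open>B\<close> in (A'1) for the first bound, and integrate
  (A'2) against \<open>\<nu> 0\<close> for the second. Hence \<open>1 - \<gamma>\<close> is a
  genuine contraction factor in [0,1).\<close>

lemma c1_le_1: "c1 \<le> 1" and c2_le_1: "c2 \<le> 1"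
proof -
  have 0: "0 \<in> I" using time_of_nat[of 0] by simp
  obtain x where x: "x \<notin> A 0" using nu_not_absorbed[OF 0] .
  interpret nu: prob_space "\<nu> t0" by (rule prob_space_nu[OF t0(1)])
  have "c1 * S 0 t0 x * measure (\<nu> t0) UNIV \<le> S 0 t0 x"
    using doeblin_set[OF 0 x, of UNIV] measure_kappa[OF 0 t0(1), of x] t0(2) sets.top[of \<E>] by (simp add: space_state)
  moreover have "measure (\<nu> t0) UNIV = 1"
    using nu.prob_space sets_eq_imp_space_eq[OF sets_nu[OF t0(1)]] by (simp add: space_state)
  ultimately show "c1 \<le> 1" using S_pos[OF 0 t0(1) _ x] t0(2) by simp
  interpret n0: prob_space "\<nu> 0" by (rule prob_space_nu[OF 0])
  have "(\<integral>y. c2 * S 0 0 y \<partial>\<nu> 0) \<le> (\<integral>y. N 0 0 \<partial>\<nu> 0)"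
    using AE_nu[OF 0] S_le_N[OF 0 0] by (intro integral_mono_AE integrable_mult_right integrable_S_nu 0) auto
  then have "c2 * N 0 0 \<le> N 0 0" by (simp add: N_def n0.prob_space)
  then show "c2 \<le> 1" using N_pos[OF 0 0] by simp
qed

lemma gamma: "0 < \<gamma>" "\<gamma> \<le> 1"
  using c1 c2 c1_le_1 c2_le_1 by (auto intro: mult_le_one)

text \<open>By \<open>S_kappa\<close> the ratio \<open>S u T' / S u T\<close> is an average of the
  ratios at the later time \<open>v\<close>, so a bound at \<open>v\<close> passes to every earlier
  \<open>u\<close>. Written without division it holds for all \<open>y\<close>, also those in
  \<open>A u\<close>.\<close>

lemma S_lower_kappa:
  assumes I: "u \<in> I" "v \<in> I" "u \<le> v" and T: "T \<in> I" "T' \<in> I" "v \<le> T" "v \<le> T'"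
    and le: "\<And>z. z \<notin> A v \<Longrightarrow> a * S v T z \<le> S v T' z"
  shows "a * S u T y \<le> S u T' y"
proof -
  have "(\<integral>z. a * S v T z \<partial>\<kappa> u v y) \<le> (\<integral>z. S v T' z \<partial>\<kappa> u v y)"
    using AE_kappa[OF I, of y] le I T by (intro integral_mono_AE integrable_mult_right integrable_S_kappa) auto
  then show ?thesis using I T by (simp add: S_kappa)
qed

lemma S_upper_kappa:
  assumes I: "u \<in> I" "v \<in> I" "u \<le> v" and T: "T \<in> I" "T' \<in> I" "v \<le> T" "v \<le> T'"
    and le: "\<And>z. z \<notin> A v \<Longrightarrow> S v T' z \<le> b * S v T z"
  shows "S u T' y \<le> b * S u T y"
proof -
  have "(\<integral>z. S v T' z \<partial>\<kappa> u v y) \<le> (\<integral>z. b * S v T z \<partial>\<kappa> u v y)"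
    using AE_kappa[OF I, of y] le I T by (intro integral_mono_AE integrable_mult_right integrable_S_kappa) auto
  then show ?thesis using I T by (simp add: S_kappa)
qed

text \<open>The Doeblin minorisation for the process conditioned on survival up to \<open>T\<close>:
  its law at time \<open>v = u + t0\<close> dominates \<open>\<gamma>\<close> times the law with
  density \<open>S v T / N v T\<close> with respect to \<open>\<nu> v\<close>. (A'1) gives the
  factor \<open>c1\<close> and the mass \<open>S u v y * N v T\<close>; (A'2), integrated against
  \<open>\<kappa> u v y\<close>, bounds that mass below by \<open>c2 * S u T y\<close>. As
  \<open>p\<close> and \<open>q\<close> may have either sign, one statement moves both the lower and
  the upper end of the interval of ratios.\<close>

lemma doeblin_step:
  assumes u: "u \<in> I" "y \<notin> A u" and T: "T \<in> I" "T' \<in> I" "u + t0 \<le> T" "u + t0 \<le> T'"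
    and nonneg: "\<And>z. z \<notin> A (u + t0) \<Longrightarrow> 0 \<le> p * S (u + t0) T z + q * S (u + t0) T' z"
  shows "\<gamma> * (p + q * (N (u + t0) T' / N (u + t0) T)) * S u T y \<le> p * S u T y + q * S u T' y"
proof -
  let ?v = "u + t0"
  have v: "?v \<in> I" "u \<le> ?v" using u t0 time_add by auto
  let ?f = "\<lambda>z. p * S ?v T z + q * S ?v T' z"
  have Npos: "0 < N ?v T" using N_pos v T by auto
  have int_nu: "integrable (\<nu> ?v) (\<lambda>z. p * S ?v T z)" "integrable (\<nu> ?v) (\<lambda>z. q * S ?v T' z)"
    using v T by (auto intro!: integrable_mult_right integrable_S_nu)
  have int_ka: "integrable (\<kappa> u ?v y) (\<lambda>z. p * S ?v T z)" "integrable (\<kappa> u ?v y) (\<lambda>z. q * S ?v T' z)"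
    using u v T by (auto intro!: integrable_mult_right integrable_S_kappa)
  have nuf: "(\<integral>z. ?f z \<partial>\<nu> ?v) = p * N ?v T + q * N ?v T'"
    using int_nu by (simp add: N_def)
  have nuf0: "0 \<le> (\<integral>z. ?f z \<partial>\<nu> ?v)"
    using AE_nu[OF v(1)] nonneg by (intro integral_nonneg_AE) auto
  have S_le: "c2 * S u T y \<le> S u ?v y * N ?v T"
  proof -
    interpret ka: finite_measure "\<kappa> u ?v y" by (rule finite_measure_kappa) fact+
    have "(\<integral>z. c2 * S ?v T z \<partial>\<kappa> u ?v y) \<le> (\<integral>z. N ?v T \<partial>\<kappa> u ?v y)"
      using AE_kappa[OF u(1) v, of y] S_le_N[OF v(1) T(1,3)] u v T
      by (intro integral_mono_AE integrable_mult_right integrable_S_kappa) auto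
    then show ?thesis using u v T by (simp add: S_kappa measure_kappa)
  qed
  have "?f \<in> borel_measurable \<E>"
    using S_measurable[OF v(1) T(1,3)] S_measurable[OF v(1) T(2,4)] by measurable
  moreover have "?f z \<le> \<bar>p\<bar> + \<bar>q\<bar>" for z
  proof -
    have "p * S ?v T z \<le> \<bar>p\<bar> * 1" "q * S ?v T' z \<le> \<bar>q\<bar> * 1"
      by (rule mult_mono; simp add: S_nonneg S_le_1 v)+
    then show ?thesis by simp
  qed
  ultimately have D: "c1 * S u ?v y * (\<integral>z. ?f z \<partial>\<nu> ?v) \<le> (\<integral>z. ?f z \<partial>\<kappa> u ?v y)"
    using doeblin[OF u, of ?f "\<bar>p\<bar> + \<bar>q\<bar>"] nonneg by blast
  have "\<gamma> * (p + q * (N ?v T' / N ?v T)) * S u T y = c1 * (c2 * S u T y) * ((\<integral>z. ?f z \<partial>\<nu> ?v) / N ?v T)"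
    unfolding nuf using Npos by (simp add: field_simps)
  also have "\<dots> \<le> c1 * (S u ?v y * N ?v T) * ((\<integral>z. ?f z \<partial>\<nu> ?v) / N ?v T)"
    using S_le c1 Npos nuf0 by (intro mult_right_mono mult_left_mono) auto
  also have "\<dots> = c1 * S u ?v y * (\<integral>z. ?f z \<partial>\<nu> ?v)"
    using Npos by simp
  also have "\<dots> \<le> (\<integral>z. ?f z \<partial>\<kappa> u ?v y)" by (rule D)
  also have "\<dots> = p * S u T y + q * S u T' y"
    using int_ka u v T by (simp add: S_kappa)
  finally show ?thesis .
qed

text \<open>Of the \<open>n + 1\<close> periods, the last one before \<open>T\<close> creates the
  positive lower end \<open>c1 * N T T'\<close>, and each of the other \<open>n\<close> shrinks the
  interval by the factor \<open>1 - \<gamma>\<close>. The lower bound on \<open>a\<close> is carried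
  along because it later turns the width of the interval into a relative error.\<close>

lemma ratio_contraction:
  assumes T: "T \<in> I" "T' \<in> I" "T \<le> T'"
  shows "u \<in> I \<Longrightarrow> u + real (Suc n) * t0 \<le> T \<Longrightarrow>
    \<exists>a b. c1 * N T T' \<le> a \<and> a \<le> b \<and> b - a \<le> (1 - \<gamma>) ^ n * (N T T' / c2) \<and>
      (\<forall>y. y \<notin> A u \<longrightarrow> a * S u T y \<le> S u T' y \<and> S u T' y \<le> b * S u T y)"
proof (induction n arbitrary: u)
  case 0
  have B: "0 < N T T'" using N_pos T by auto
  have v: "T - t0 \<in> I" "u \<le> T - t0" "u \<le> T" "u \<le> T'" using 0 T t0 time_nonneg[of u] by (auto intro: time_diff)
  have ab: "c1 * N T T' \<le> N T T' / c2"
    using gamma(2) c2 B by (simp add: field_simps mult_le_cancel_left2)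
  \<comment> \<open>(A'1) over the final period gives this lower bound at \<open>T - t0\<close>;
    averaging carries it back to \<open>u\<close>.\<close>
  have low: "c1 * N T T' * S u T y \<le> S u T' y" for y
  proof (rule S_lower_kappa[of u "T - t0"])
    fix z assume z: "z \<notin> A (T - t0)"
    have "c1 * S (T - t0) T z * (\<integral>y. S T T' y \<partial>\<nu> T) \<le> (\<integral>y. S T T' y \<partial>\<kappa> (T - t0) T z)"
      using doeblin[OF v(1) z, of "S T T'" 1] T by (simp add: S_measurable S_nonneg S_le_1)
    then show "c1 * N T T' * S (T - t0) T z \<le> S (T - t0) T' z"
      using v T t0 by (simp add: S_kappa N_def mult_ac)
  qed (use v T t0 0 in auto)
  \<comment> \<open>The upper end is (A'2) at time \<open>T\<close>, averaged over the position at
    \<open>T\<close>.\<close>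
  have up: "S u T' y \<le> N T T' / c2 * S u T y" for y
  proof -
    interpret ka: finite_measure "\<kappa> u T y" by (rule finite_measure_kappa) (use v T 0 in auto)
    have "(\<integral>z. S T T' z \<partial>\<kappa> u T y) \<le> (\<integral>z. N T T' / c2 \<partial>\<kappa> u T y)"
      using AE_kappa[of u T y] S_le_N[OF T] c2 v T 0
      by (intro integral_mono_AE integrable_S_kappa) (auto simp: field_simps)
    then show ?thesis using v T 0 by (simp add: S_kappa measure_kappa mult_ac)
  qed
  show ?case
    using ab low up c1 B by (intro exI[of _ "c1 * N T T'"] exI[of _ "N T T' / c2"]) auto
next
  case (Suc n)
  let ?v = "u + t0"
  have v: "?v \<in> I" "?v + real (Suc n) * t0 \<le> T" "u \<le> ?v" using Suc t0 time_add by (auto simp: algebra_simps)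
  have vT: "?v \<le> T" "?v \<le> T'" using v T t0 by (auto intro: order_trans[rotated])
  from Suc.IH[OF v(1,2)] obtain a b where ab: "c1 * N T T' \<le> a" "a \<le> b" "b - a \<le> (1 - \<gamma>) ^ n * (N T T' / c2)"
    and S: "\<And>y. y \<notin> A ?v \<Longrightarrow> a * S ?v T y \<le> S ?v T' y" "\<And>y. y \<notin> A ?v \<Longrightarrow> S ?v T' y \<le> b * S ?v T y"
    by blast
  \<comment> \<open>\<open>m\<close> is the average of the ratio under the common component, which
    has density \<open>S v T / N v T\<close> with respect to \<open>\<nu> v\<close>. It lies between
    \<open>a\<close> and \<open>b\<close> and does not depend on the starting point
    \<open>y\<close>.\<close>
  define m where "m = N ?v T' / N ?v T"
  have Npos: "0 < N ?v T" using N_pos v T vT by auto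
  have int_nu: "integrable (\<nu> ?v) (S ?v T)" "integrable (\<nu> ?v) (S ?v T')"
    using v T vT by (auto intro!: integrable_S_nu)
  have "(\<integral>z. a * S ?v T z \<partial>\<nu> ?v) \<le> (\<integral>z. S ?v T' z \<partial>\<nu> ?v)"
       "(\<integral>z. S ?v T' z \<partial>\<nu> ?v) \<le> (\<integral>z. b * S ?v T z \<partial>\<nu> ?v)"
    using AE_nu[OF v(1)] S by (intro integral_mono_AE integrable_mult_right int_nu; auto)+
  then have m: "a \<le> m" "m \<le> b"
    using Npos by (auto simp: m_def N_def[symmetric] field_simps)
  \<comment> \<open>Each end moves towards \<open>m\<close> by the fraction \<open>\<gamma>\<close>
    of its distance, which leaves the width \<open>(1 - \<gamma>) * (b - a)\<close>.\<close>
  let ?a = "a + \<gamma> * (m - a)" and ?b = "b - \<gamma> * (b - m)"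
  have low: "?a * S u T y \<le> S u T' y" if "y \<notin> A u" for y
    using doeblin_step[OF Suc.prems(1) that T(1,2) vT, of "- a" 1, folded m_def] S(1) by (simp add: algebra_simps)
  have up: "S u T' y \<le> ?b * S u T y" if "y \<notin> A u" for y
    using doeblin_step[OF Suc.prems(1) that T(1,2) vT, of b "- 1", folded m_def] S(2) by (simp add: algebra_simps)
  have "?b - ?a = (1 - \<gamma>) * (b - a)" by (simp add: algebra_simps)
  also have "\<dots> \<le> (1 - \<gamma>) * ((1 - \<gamma>) ^ n * (N T T' / c2))"
    using ab gamma by (intro mult_left_mono) auto
  finally have "?b - ?a \<le> (1 - \<gamma>) ^ Suc n * (N T T' / c2)" by simp
  moreover have "c1 * N T T' \<le> ?a" using ab m gamma by (auto intro: order_trans add_increasing2)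
  moreover have "?a \<le> ?b"
  proof -
    have "0 \<le> (1 - \<gamma>) * (b - a)" using gamma ab by auto
    then show ?thesis by (simp add: algebra_simps)
  qed
  ultimately show ?case using low up by blast
qed

section \<open>The limiting harmonic function\<close>

definition Z :: "real \<Rightarrow> real" where "Z T = N 0 T"

text \<open>An upper bound for \<open>(1 - \<gamma>) ^ n / \<gamma>\<close>, where
  \<open>n + 1\<close> is the number of whole periods in \<open>d\<close>, obtained from
  \<open>1 - \<gamma> \<le> exp (- \<gamma>)\<close> and \<open>n \<ge> d / t0 - 2\<close>. The
  factor \<open>1 / \<gamma>\<close> is the quotient of the initial width bound
  \<open>N T T' / c2\<close> by the lower end \<open>c1 * N T T'\<close>.\<close>

definition rate :: "real \<Rightarrow> real" where
  "rate d = exp (2 * \<gamma>) / \<gamma> * exp (- (\<gamma> / t0) * d)"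

text \<open>The times \<open>t + n\<close> stay in \<open>I\<close> both in discrete and in
  continuous time; \<open>H_close\<close> recovers arbitrary \<open>T\<close>. Convergence is proved
  only off \<open>A t\<close>.\<close>

definition H :: "real \<Rightarrow> 'e \<Rightarrow> real" where
  "H t y = lim (\<lambda>n. S t (t + real n) y / Z (t + real n))"

lemma Z_pos: "T \<in> I \<Longrightarrow> 0 < Z T"
  unfolding Z_def using time_of_nat[of 0] time_nonneg[of T] by (intro N_pos) auto

lemma rate_pos: "0 < rate d"
  unfolding rate_def using gamma by auto

lemma rate_tendsto: "((\<lambda>T. rate (T - t)) \<longlongrightarrow> 0) at_top"
proof -
  have k: "- (\<gamma> / t0) < 0" using gamma t0 by simp
  have "filterlim (\<lambda>T. - t + T) at_top at_top"
    by (rule filterlim_tendsto_add_at_top[OF tendsto_const filterlim_ident])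
  then have "filterlim (\<lambda>T. - (\<gamma> / t0) * (T - t)) at_bot at_top"
    using filterlim_tendsto_neg_mult_at_bot[OF tendsto_const k] by simp
  then have "((\<lambda>T. exp (- (\<gamma> / t0) * (T - t))) \<longlongrightarrow> 0) at_top"
    by (rule filterlim_compose[OF exp_at_bot])
  then show ?thesis unfolding rate_def by (rule tendsto_mult_right_zero)
qed

lemma geometric_le_rate:
  assumes "t0 \<le> d"
  obtains n where "real (Suc n) * t0 \<le> d" "(1 - \<gamma>) ^ n / \<gamma> \<le> rate d"
proof
  \<comment> \<open>One period is subtracted because \<open>ratio_contraction\<close> uses
    \<open>n + 1\<close> of them; \<open>t0 \<le> d\<close> keeps the natural subtraction from
    truncating.\<close>
  define n where "n = nat \<lfloor>d / t0\<rfloor> - 1"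
  have f: "1 \<le> \<lfloor>d / t0\<rfloor>" using assms t0 by (simp add: le_floor_iff)
  then have n: "real (Suc n) = of_int \<lfloor>d / t0\<rfloor>" by (simp add: n_def)
  show "real (Suc n) * t0 \<le> d"
    unfolding n by (rule pos_le_divide_eq[OF t0(2), THEN iffD1]) simp
  have "d / t0 - 2 \<le> n" using n by linarith
  then have le: "- (\<gamma> * real n) \<le> 2 * \<gamma> - \<gamma> / t0 * d"
    using mult_left_mono[of "d / t0 - 2" n \<gamma>] gamma by (simp add: algebra_simps)
  have "(1 - \<gamma>) ^ n \<le> exp (- \<gamma>) ^ n"
    using gamma exp_ge_add_one_self[of "- \<gamma>"] by (intro power_mono) auto
  also have "\<dots> = exp (- (\<gamma> * real n))" by (simp add: exp_of_nat_mult[symmetric] mult_ac)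
  also have "\<dots> \<le> exp (2 * \<gamma>) * exp (- (\<gamma> / t0) * d)"
    using le by (simp add: exp_add[symmetric])
  finally show "(1 - \<gamma>) ^ n / \<gamma> \<le> rate d"
    unfolding rate_def using gamma by (simp add: divide_right_mono)
qed

text \<open>Both \<open>S u T' y / S u T y\<close> and \<open>z = Z T' / Z T\<close> lie in the
  interval [a,b] of \<open>ratio_contraction\<close>, the second because it arises by averaging over
  \<open>\<kappa> 0 u\<close> and then over \<open>\<nu> 0\<close>. So they differ by at most
  \<open>b - a\<close>, which is at most \<open>rate (T - u)\<close> times \<open>a\<close>, hence
  times \<open>z\<close>. The unknown size of \<open>N T T'\<close> thus drops out on division by
  \<open>Z T'\<close>.\<close>

lemma normalized_survival_close:
  assumes u: "u \<in> I" "y \<notin> A u" and T: "T \<in> I" "T' \<in> I" "T \<le> T'" "t0 \<le> T - u"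
  shows "\<bar>S u T' y / Z T' - S u T y / Z T\<bar> \<le> rate (T - u) * (S u T y / Z T)"
proof -
  obtain n where n: "real (Suc n) * t0 \<le> T - u" "(1 - \<gamma>) ^ n / \<gamma> \<le> rate (T - u)"
    using geometric_le_rate[OF T(4)] .
  obtain a b where ab: "c1 * N T T' \<le> a" "a \<le> b" "b - a \<le> (1 - \<gamma>) ^ n * (N T T' / c2)"
    and S: "\<And>y. y \<notin> A u \<Longrightarrow> a * S u T y \<le> S u T' y" "\<And>y. y \<notin> A u \<Longrightarrow> S u T' y \<le> b * S u T y"
    using ratio_contraction[OF T(1-3) u(1), of n] n(1) by auto
  have B: "0 < N T T'" using N_pos T by auto
  then have a: "0 < a" using ab(1) c1 by (meson less_le_trans mult_pos_pos)
  have 0: "0 \<in> I" "0 \<le> u" "u \<le> T" "u \<le> T'" using time_of_nat[of 0] time_nonneg[OF u(1)] T t0 by auto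
  note Zp = Z_pos[OF T(1)] Z_pos[OF T(2)]
  have "(\<integral>y. a * S 0 T y \<partial>\<nu> 0) \<le> (\<integral>y. S 0 T' y \<partial>\<nu> 0)"
    using S_lower_kappa[OF 0(1) u(1) 0(2) T(1,2) 0(3,4) S(1)] 0 T
    by (intro integral_mono integrable_mult_right integrable_S_nu) auto
  then have Za: "a * Z T \<le> Z T'" by (simp add: Z_def N_def)
  have "(\<integral>y. S 0 T' y \<partial>\<nu> 0) \<le> (\<integral>y. b * S 0 T y \<partial>\<nu> 0)"
    using S_upper_kappa[OF 0(1) u(1) 0(2) T(1,2) 0(3,4) S(2)] 0 T
    by (intro integral_mono integrable_mult_right integrable_S_nu) auto
  then have Zb: "Z T' \<le> b * Z T" by (simp add: Z_def N_def)
  define s where "s = S u T y"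
  define z where "z = Z T' / Z T"
  have s: "0 \<le> s" "a * s \<le> S u T' y" "S u T' y \<le> b * s"
    using S[OF u(2)] by (auto simp: s_def S_nonneg)
  have z: "a \<le> z" "z \<le> b" using Za Zb Zp by (auto simp: z_def field_simps)
  have "\<bar>S u T' y - z * s\<bar> \<le> (b - a) * s"
  proof -
    have "a * s \<le> z * s" "z * s \<le> b * s" using z s by (auto intro: mult_right_mono)
    then show ?thesis using s by (simp add: algebra_simps abs_le_iff)
  qed
  also have "(b - a) * s \<le> rate (T - u) * z * s"
  proof (intro mult_right_mono s)
    have "b - a \<le> (1 - \<gamma>) ^ n / \<gamma> * (c1 * N T T')" using ab(3) c1 c2 by simp
    also have "\<dots> \<le> rate (T - u) * z"
      using n(2) ab(1) z(1) rate_pos[of "T - u"] B c1 by (intro mult_mono) auto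
    finally show "b - a \<le> rate (T - u) * z" .
  qed
  finally have "\<bar>S u T' y - z * s\<bar> / Z T' \<le> (rate (T - u) * z * s) / Z T'"
    using Zp by (intro divide_right_mono) auto
  also have "(rate (T - u) * z * s) / Z T' = rate (T - u) * (s / Z T)"
    using Zp by (simp add: z_def)
  also have "\<bar>S u T' y - z * s\<bar> / Z T' = \<bar>S u T' y / Z T' - s / Z T\<bar>"
    using Zp by (subst abs_div_pos) (auto simp: z_def diff_divide_distrib)
  finally show ?thesis by (simp add: s_def)
qed

text \<open>The estimate is relative, so the Cauchy property first needs boundedness: from index
  \<open>m\<close> on, all terms are at most \<open>K\<close>.\<close>

lemma H_tendsto:
  assumes u: "u \<in> I" "y \<notin> A u"
  shows "(\<lambda>n. S u (u + real n) y / Z (u + real n)) \<longlonglongrightarrow> H u y"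
proof -
  let ?q = "\<lambda>n. S u (u + real n) y / Z (u + real n)"
  define m where "m = nat \<lceil>t0\<rceil>"
  have m: "t0 \<le> real m" unfolding m_def by linarith
  have uI: "u + real n \<in> I" for n by (rule time_add[OF u(1) time_of_nat])
  have close: "\<bar>?q n - ?q k\<bar> \<le> rate (real k) * ?q k" if "m \<le> k" "k \<le> n" for k n
    using normalized_survival_close[OF u uI[of k] uI[of n]] m that by simp
  define K where "K = (1 + rate (real m)) * ?q m"
  have qK: "?q n \<le> K" if "m \<le> n" for n
    using abs_le_D1[OF close[of m n]] that unfolding K_def distrib_right by simp
  have "Cauchy ?q"
  proof (rule metric_CauchyI)
    fix e :: real assume e: "0 < e"
    have "((\<lambda>n. rate (real n) * K) \<longlongrightarrow> 0 * K) sequentially"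
      using filterlim_compose[OF rate_tendsto[of 0] filterlim_real_sequentially]
      by (intro tendsto_intros) simp
    then have "eventually (\<lambda>n. rate (real n) * K < e / 2) sequentially"
      using order_tendstoD(2)[of _ "0 * K" sequentially "e / 2"] e by simp
    then obtain M0 where M0: "\<And>n. M0 \<le> n \<Longrightarrow> rate (real n) * K < e / 2"
      by (auto simp: eventually_sequentially)
    define M where "M = max M0 m"
    have d: "dist (?q n) (?q M) < e / 2" if "M \<le> n" for n
    proof -
      have "\<bar>?q n - ?q M\<bar> \<le> rate (real M) * ?q M"
        using close[of M n] that by (simp add: M_def)
      also have "\<dots> \<le> rate (real M) * K"
        using qK[of M] rate_pos[of "real M"] by (intro mult_left_mono) (auto simp: M_def)
      also have "\<dots> < e / 2" using M0[of M] by (simp add: M_def)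
      finally show ?thesis by (simp add: dist_real_def)
    qed
    show "\<exists>M. \<forall>i\<ge>M. \<forall>n\<ge>M. dist (?q i) (?q n) < e"
      using dist_triangle_half_l[OF d d] by blast
  qed
  then show ?thesis unfolding H_def by (simp add: Cauchy_convergent_iff convergent_LIMSEQ_iff)
qed

lemma H_close:
  assumes u: "u \<in> I" "y \<notin> A u" and T: "T \<in> I" "t0 \<le> T - u"
  shows "\<bar>H u y - S u T y / Z T\<bar> \<le> rate (T - u) * (S u T y / Z T)"
proof (rule tendsto_upperbound)
  let ?q = "\<lambda>n. S u (u + real n) y / Z (u + real n)"
  show "(\<lambda>n. \<bar>?q n - S u T y / Z T\<bar>) \<longlonglongrightarrow> \<bar>H u y - S u T y / Z T\<bar>"
    by (intro tendsto_intros H_tendsto u)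
  have "eventually (\<lambda>n. T \<le> u + real n) sequentially"
    using eventually_ge_at_top[of "T - u", THEN eventually_compose_filterlim[OF _ filterlim_real_sequentially]]
    by eventually_elim simp
  then show "\<forall>\<^sub>F n in sequentially. \<bar>?q n - S u T y / Z T\<bar> \<le> rate (T - u) * (S u T y / Z T)"
    by eventually_elim (use normalized_survival_close[OF u T(1) _ _ T(2)] time_add[OF u(1) time_of_nat] in auto)
qed auto

text \<open>Once \<open>rate n < 1\<close>, the error in \<open>H_close\<close> is too small to
  cancel the positive term \<open>S u (u + n) y / Z (u + n)\<close>.\<close>

lemma H_pos:
  assumes u: "u \<in> I" "y \<notin> A u"
  shows "0 < H u y"
proof -
  have "eventually (\<lambda>n. rate (real n) < 1) sequentially"
    using order_tendstoD(2)[OF filterlim_compose[OF rate_tendsto[of 0] filterlim_real_sequentially], of 1] by simp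
  moreover have "eventually (\<lambda>n. t0 \<le> real n) sequentially"
    by (rule eventually_ge_at_top[THEN eventually_compose_filterlim[OF _ filterlim_real_sequentially]])
  ultimately have "\<exists>n. rate (real n) < 1 \<and> t0 \<le> real n"
    by (intro eventually_happens'[OF sequentially_bot] eventually_conj)
  then obtain n where n: "rate (real n) < 1" "t0 \<le> real n" by auto
  let ?q = "S u (u + real n) y / Z (u + real n)"
  have uI: "u + real n \<in> I" by (rule time_add[OF u(1) time_of_nat])
  have q: "0 < ?q" using S_pos[OF u(1) uI _ u(2)] Z_pos[OF uI] by simp
  have "\<bar>H u y - ?q\<bar> \<le> rate (real n) * ?q"
    using n H_close[OF u uI] by simp
  also have "\<dots> < ?q" using mult_strict_right_mono[OF n(1) q] by simp
  finally show ?thesis by simp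
qed

text \<open>One comparison at \<open>T = u + t0\<close> suffices, as survival probabilities are at
  most 1. The bound provides integrability under the killed kernels.\<close>

lemma H_bounded:
  assumes "u \<in> I"
  shows "\<exists>c. \<forall>y. y \<notin> A u \<longrightarrow> \<bar>H u y\<bar> \<le> c"
proof (intro exI allI impI)
  fix y assume y: "y \<notin> A u"
  let ?T = "u + t0"
  have T: "?T \<in> I" using assms t0 time_add by auto
  have "S u ?T y / Z ?T \<le> 1 / Z ?T" using S_le_1[OF assms] Z_pos[OF T] by (intro divide_right_mono) auto
  moreover have "\<bar>H u y - S u ?T y / Z ?T\<bar> \<le> rate t0 * (S u ?T y / Z ?T)"
    using H_close[OF assms y T] by simp
  moreover have "rate t0 * (S u ?T y / Z ?T) \<le> rate t0 * (1 / Z ?T)"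
    using calculation(1) rate_pos[of t0] by (intro mult_left_mono) auto
  ultimately show "\<bar>H u y\<bar> \<le> 1 / Z ?T + rate t0 * (1 / Z ?T)"
    using H_pos[OF assms y] by linarith
qed

lemma H_measurable [measurable]:
  assumes "t \<in> I"
  shows "H t \<in> borel_measurable \<E>"
  unfolding H_def using S_measurable[OF assms time_add[OF assms time_of_nat]]
  by (intro borel_measurable_lim_metric borel_measurable_divide borel_measurable_const) auto

text \<open>Harmonicity of \<open>H\<close> for the killed semigroup. The quotients
  \<open>S t T / Z T\<close> satisfy it exactly, by \<open>S_kappa\<close>. Integrating the relative
  error of \<open>H_close\<close> against \<open>\<kappa> s t x\<close> reproduces
  \<open>S s T x / Z T\<close>, so the error at \<open>s\<close> is at most
  \<open>rate (T - t)\<close> times a convergent sequence.\<close>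

lemma H_kappa:
  assumes I: "s \<in> I" "t \<in> I" "s \<le> t" and x: "x \<notin> A s"
  shows "(\<integral>y. H t y \<partial>\<kappa> s t x) = H s x"
proof -
  let ?q = "\<lambda>n. S s (s + real n) x / Z (s + real n)"
  let ?L = "\<integral>y. H t y \<partial>\<kappa> s t x"
  from H_bounded[OF I(2)] obtain c where c: "\<forall>y. y \<notin> A t \<longrightarrow> \<bar>H t y\<bar> \<le> c" ..
  have int_H: "integrable (\<kappa> s t x) (H t)"
    by (rule integrable_kappa[OF I H_measurable[OF I(2)], of c]) (rule c[rule_format])
  have uI: "s + real n \<in> I" for n by (rule time_add[OF I(1) time_of_nat])
  have bound: "\<bar>?q n - ?L\<bar> \<le> rate (real n - (t - s)) * ?q n" if n: "t0 + (t - s) \<le> real n" for n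
  proof -
    let ?T = "s + real n"
    have le: "t \<le> ?T" "t0 \<le> ?T - t" using n t0 by auto
    have int_S: "integrable (\<kappa> s t x) (\<lambda>y. S t ?T y / Z ?T)"
      using I uI le by (intro integrable_divide integrable_S_kappa) auto
    have q: "?q n = (\<integral>y. S t ?T y / Z ?T \<partial>\<kappa> s t x)"
      using S_kappa[OF I(1,2) uI I(3) le(1)] by simp
    have diff: "?L - ?q n = (\<integral>y. H t y - S t ?T y / Z ?T \<partial>\<kappa> s t x)"
      unfolding q using int_H int_S by (rule Bochner_Integration.integral_diff[symmetric])
    have T: "?T - t = real n - (t - s)" by simp
    have "\<bar>\<integral>y. H t y - S t ?T y / Z ?T \<partial>\<kappa> s t x\<bar> \<le> (\<integral>y. \<bar>H t y - S t ?T y / Z ?T\<bar> \<partial>\<kappa> s t x)"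
      by (rule integral_abs_bound)
    also have "\<dots> \<le> (\<integral>y. rate (real n - (t - s)) * (S t ?T y / Z ?T) \<partial>\<kappa> s t x)"
    proof (rule integral_mono_AE)
      show "AE y in \<kappa> s t x. \<bar>H t y - S t ?T y / Z ?T\<bar> \<le> rate (real n - (t - s)) * (S t ?T y / Z ?T)"
        using AE_kappa[OF I, of x]
        by eventually_elim (rule H_close[OF I(2) _ uI le(2), unfolded T])
      show "integrable (\<kappa> s t x) (\<lambda>y. \<bar>H t y - S t ?T y / Z ?T\<bar>)"
        by (rule integrable_abs[OF Bochner_Integration.integrable_diff[OF int_H int_S]])
      show "integrable (\<kappa> s t x) (\<lambda>y. rate (real n - (t - s)) * (S t ?T y / Z ?T))"
        by (rule integrable_mult_right[OF int_S])
    qed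
    also have "\<dots> = rate (real n - (t - s)) * ?q n"
      unfolding q by (rule integral_mult_right_zero)
    finally show ?thesis
      unfolding diff[symmetric] abs_minus_commute[of ?L] .
  qed
  have rate_lim: "(\<lambda>n. rate (real n - (t - s))) \<longlonglongrightarrow> 0"
    using filterlim_compose[OF rate_tendsto[of "t - s"] filterlim_real_sequentially] .
  have null: "(\<lambda>n. rate (real n - (t - s)) * ?q n) \<longlonglongrightarrow> 0"
    using tendsto_mult[OF rate_lim H_tendsto[OF I(1) x]] unfolding mult_zero_left .
  have "eventually (\<lambda>n. t0 + (t - s) \<le> real n) sequentially"
    by (rule eventually_ge_at_top[THEN eventually_compose_filterlim[OF _ filterlim_real_sequentially]])
  then have "eventually (\<lambda>n. norm (?q n - ?L) \<le> rate (real n - (t - s)) * ?q n) sequentially"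
    by (rule eventually_mono) (unfold real_norm_def, rule bound)
  then have "(\<lambda>n. ?q n - ?L) \<longlonglongrightarrow> 0"
    using null by (rule Lim_null_comparison)
  then have "?q \<longlonglongrightarrow> ?L" by (rule LIM_zero_cancel)
  then show ?thesis using H_tendsto[OF I(1) x] by (rule LIMSEQ_unique)
qed

lemma W_H:
  assumes I: "s \<in> I" "t \<in> I" "s \<le> t" and x: "x \<notin> A s"
  shows "W s t (\<lambda>y. ennreal (H t y)) x = ennreal (H s x)"
proof -
  from H_bounded[OF I(2)] obtain c where c: "\<forall>y. y \<notin> A t \<longrightarrow> \<bar>H t y\<bar> \<le> c" ..
  have "integrable (\<kappa> s t x) (H t)"
    by (rule integrable_kappa[OF I H_measurable[OF I(2)], of c]) (rule c[rule_format])
  moreover have "AE y in \<kappa> s t x. 0 \<le> H t y"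
    using AE_kappa[OF I, of x] by eventually_elim (rule less_imp_le[OF H_pos[OF I(2)]])
  ultimately have int: "(\<integral>\<^sup>+y. ennreal (H t y) \<partial>\<kappa> s t x) = ennreal (\<integral>y. H t y \<partial>\<kappa> s t x)"
    by (rule nn_integral_eq_integral)
  have "(\<lambda>y. ennreal (H t y)) \<in> borel_measurable \<E>"
    by (rule measurable_compose[OF H_measurable[OF I(2)] measurable_ennreal])
  from nn_integral_kappa[OF I this, of x] show ?thesis
    unfolding int H_kappa[OF I x] by (rule sym)
qed

end

section \<open>Conditioned path laws and their limits\<close>

text \<open>Here \<open>a1\<close> and \<open>b1\<close> are masses of two unnormalised measures,
  and \<open>af\<close> and \<open>bf\<close> integrals of a test function bounded by 1. Exchanging
  numerator and denominator one after the other costs \<open>r\<close> each, whence the factor 2 in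
  the final constant.\<close>

lemma ratio_difference_le:
  fixes a1 :: real
  assumes "0 < a1" "0 < b1" "\<bar>af - bf\<bar> \<le> r * a1" "\<bar>a1 - b1\<bar> \<le> r * a1" "\<bar>bf\<bar> \<le> b1"
  shows "\<bar>af / a1 - bf / b1\<bar> \<le> 2 * r"
proof -
  have "af / a1 - bf / b1 = (af - bf) / a1 + (bf / b1) * ((b1 - a1) / a1)"
    using assms(1,2) by (simp add: field_simps)
  also have "\<bar>\<dots>\<bar> \<le> \<bar>af - bf\<bar> / a1 + \<bar>bf / b1\<bar> * (\<bar>a1 - b1\<bar> / a1)"
    using assms(1) by (intro order_trans[OF abs_triangle_ineq]) (simp add: abs_mult abs_minus_commute)
  also have "\<dots> \<le> r + 1 * r"
    using assms by (intro add_mono mult_mono) (auto simp: field_simps)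
  finally show ?thesis by simp
qed

context homogeneous_markov_process
begin

abbreviation path :: "real \<Rightarrow> real \<Rightarrow> 'w \<Rightarrow> real \<Rightarrow> 'e" where
  "path s t \<omega> \<equiv> \<lambda>u\<in>I \<inter> {s..t}. X u \<omega>"

lemma measurable_path: "path s t \<in> past s t \<rightarrow>\<^sub>M PiM (I \<inter> {s..t}) (\<lambda>_. \<E>)"
  by (intro measurable_restrict measurable_X)

lemma measurable_path_P: "s \<in> I \<Longrightarrow> path s t \<in> P s x \<rightarrow>\<^sub>M PiM (I \<inter> {s..t}) (\<lambda>_. \<E>)"
  by (intro measurable_P past_future[OF order_refl measurable_path])

end

context absorbed_markov_process
begin

lemma measurable_surv_X:
  assumes "s \<in> I" "t \<in> I" "s \<le> t" "w \<in> borel_measurable \<E>"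
  shows "(\<lambda>\<omega>. indicator (surv s t) \<omega> * (w (X t \<omega>) :: ennreal)) \<in> borel_measurable (past s t)"
proof -
  have [measurable]: "surv s t \<in> sets (past s t)" "X t \<in> past s t \<rightarrow>\<^sub>M \<E>" "w \<in> borel_measurable \<E>"
    using assms sets_surv by (auto intro!: measurable_X)
  show ?thesis by measurable
qed

text \<open>The law of the killed trajectory, reweighted by a function of its endpoint. The weight
  \<open>S t T / S s T x\<close> gives the conditioned law and \<open>H t / H s x\<close> that of
  the \<open>Q\<close>-process.\<close>

definition path_law :: "real \<Rightarrow> real \<Rightarrow> 'e \<Rightarrow> ('e \<Rightarrow> real) \<Rightarrow> (real \<Rightarrow> 'e) measure" where
  "path_law s t x h = distr (density (P s x) (\<lambda>\<omega>. indicator (surv s t) \<omega> * ennreal (h (X t \<omega>))))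
     (PiM (I \<inter> {s..t}) (\<lambda>_. \<E>)) (path s t)"

lemma nn_integral_path_law:
  assumes st: "s \<in> I" "t \<in> I" "s \<le> t" and h: "h \<in> borel_measurable \<E>"
    and g: "g \<in> borel_measurable (PiM (I \<inter> {s..t}) (\<lambda>_. \<E>))"
  shows "(\<integral>\<^sup>+y. g y \<partial>path_law s t x h) =
    (\<integral>\<^sup>+\<omega>. g (path s t \<omega>) * (indicator (surv s t) \<omega> * ennreal (h (X t \<omega>))) \<partial>P s x)"
proof -
  have m: "(\<lambda>\<omega>. indicator (surv s t) \<omega> * ennreal (h (X t \<omega>))) \<in> borel_measurable (P s x)"
    using st h by (intro measurable_P past_future[OF order_refl measurable_surv_X]) auto
  have p: "path s t \<in> P s x \<rightarrow>\<^sub>M PiM (I \<inter> {s..t}) (\<lambda>_. \<E>)"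
    by (rule measurable_path_P) fact
  show ?thesis
    unfolding path_law_def using g m p measurable_compose[OF p g]
    by (simp add: nn_integral_distr nn_integral_density mult_ac)
qed

lemma integral_path_law:
  assumes st: "s \<in> I" "t \<in> I" "s \<le> t" and h: "h \<in> borel_measurable \<E>" and h0: "\<And>y. y \<notin> A t \<Longrightarrow> 0 \<le> h y"
    and g: "g \<in> borel_measurable (PiM (I \<inter> {s..t}) (\<lambda>_. \<E>))"
  shows "(\<integral>y. g y \<partial>path_law s t x h) =
    (\<integral>\<omega>. g (path s t \<omega>) * (indicator (surv s t) \<omega> * h (X t \<omega>)) \<partial>P s x)"
proof -
  have p: "path s t \<in> P s x \<rightarrow>\<^sub>M PiM (I \<inter> {s..t}) (\<lambda>_. \<E>)"
    by (rule measurable_path_P) fact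
  have [measurable]: "surv s t \<in> sets (P s x)" "X t \<in> P s x \<rightarrow>\<^sub>M \<E>" "h \<in> borel_measurable \<E>"
    using st h sets_surv_future by (auto intro!: measurable_P measurable_X simp: sets_P)
  have eq: "(\<lambda>\<omega>. indicator (surv s t) \<omega> * ennreal (h (X t \<omega>))) = (\<lambda>\<omega>. ennreal (indicator (surv s t) \<omega> * h (X t \<omega>)))"
    by (auto split: split_indicator)
  have "(\<integral>y. g y \<partial>path_law s t x h) = (\<integral>\<omega>. g (path s t \<omega>) \<partial>density (P s x) (\<lambda>\<omega>. ennreal (indicator (surv s t) \<omega> * h (X t \<omega>))))"
    unfolding path_law_def eq using p g by (intro integral_distr) auto
  also have "\<dots> = (\<integral>\<omega>. (indicator (surv s t) \<omega> * h (X t \<omega>)) *\<^sub>R g (path s t \<omega>) \<partial>P s x)"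
    using measurable_compose[OF p g] h0 surv_not_absorbed[OF st(2,3)]
    by (intro integral_density) (auto split: split_indicator)
  finally show ?thesis by (simp add: mult_ac)
qed

lemma integral_kappa:
  fixes h :: "'e \<Rightarrow> real"
  assumes st: "s \<in> I" "t \<in> I" "s \<le> t" and h: "h \<in> borel_measurable \<E>"
  shows "(\<integral>y. h y \<partial>\<kappa> s t x) = (\<integral>\<omega>. indicator (surv s t) \<omega> * h (X t \<omega>) \<partial>P s x)"
proof -
  have [measurable]: "surv s t \<in> sets (P s x)" "X t \<in> P s x \<rightarrow>\<^sub>M \<E>" "h \<in> borel_measurable \<E>"
    using st h sets_surv_future by (auto intro!: measurable_P measurable_X simp: sets_P)
  have "(\<integral>y. h y \<partial>\<kappa> s t x) = (\<integral>\<omega>. h (X t \<omega>) \<partial>density (P s x) (\<lambda>\<omega>. ennreal (indicator (surv s t) \<omega>)))"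
    unfolding \<kappa>_def ennreal_indicator by (subst integral_distr) auto
  also have "\<dots> = (\<integral>\<omega>. indicator (surv s t) \<omega> *\<^sub>R h (X t \<omega>) \<partial>P s x)"
    by (intro integral_density) auto
  finally show ?thesis by simp
qed

lemma integrable_surv_X:
  assumes st: "s \<in> I" "t \<in> I" "s \<le> t" and h: "h \<in> borel_measurable \<E>" and hc: "\<And>y. y \<notin> A t \<Longrightarrow> \<bar>h y\<bar> \<le> c"
    and g: "g \<in> borel_measurable (P s x)" "\<And>\<omega>. \<omega> \<in> \<Omega> \<Longrightarrow> \<bar>g \<omega>\<bar> \<le> 1"
  shows "integrable (P s x) (\<lambda>\<omega>. g \<omega> * (indicator (surv s t) \<omega> * h (X t \<omega>)) :: real)"
proof -
  interpret prob_space "P s x" by (rule prob_space_P) fact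
  have [measurable]: "surv s t \<in> sets (P s x)" "X t \<in> P s x \<rightarrow>\<^sub>M \<E>" "h \<in> borel_measurable \<E>" "g \<in> borel_measurable (P s x)"
    using st h sets_surv_future g by (auto intro!: measurable_P measurable_X simp: sets_P)
  show ?thesis
  proof (rule integrable_const_bound[of _ "\<bar>c\<bar>"])
    show "AE \<omega> in P s x. norm (g \<omega> * (indicator (surv s t) \<omega> * h (X t \<omega>))) \<le> \<bar>c\<bar>"
    proof (rule AE_I2)
      fix \<omega> assume "\<omega> \<in> space (P s x)"
      then have "\<bar>g \<omega>\<bar> \<le> 1" using g st by (simp add: space_P)
      moreover have "\<bar>indicator (surv s t) \<omega> * h (X t \<omega>)\<bar> \<le> \<bar>c\<bar>"
        using hc[of "X t \<omega>"] surv_not_absorbed[OF st(2,3), of \<omega>] by (auto split: split_indicator)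
      ultimately have "\<bar>g \<omega>\<bar> * \<bar>indicator (surv s t) \<omega> * h (X t \<omega>)\<bar> \<le> 1 * \<bar>c\<bar>"
        by (intro mult_mono) auto
      then show "norm (g \<omega> * (indicator (surv s t) \<omega> * h (X t \<omega>))) \<le> \<bar>c\<bar>" by (simp add: abs_mult)
    qed
  qed measurable
qed

lemma prob_space_path_law:
  assumes st: "s \<in> I" "t \<in> I" "s \<le> t" and h: "h \<in> borel_measurable \<E>" and 1: "W s t (\<lambda>y. ennreal (h y)) x = 1"
  shows "prob_space (path_law s t x h)"
proof
  have "emeasure (path_law s t x h) (space (path_law s t x h)) = (\<integral>\<^sup>+y. 1 \<partial>path_law s t x h)"
    by simp
  also have "\<dots> = 1" using 1 by (subst nn_integral_path_law[OF st h]) (auto simp: W_def)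
  finally show "emeasure (path_law s t x h) (space (path_law s t x h)) = 1" .
qed

text \<open>By the Markov property at \<open>t\<close>, given a trajectory that has survived up to
  \<open>t\<close>, survival up to \<open>T\<close> has conditional probability
  \<open>S t T (X t)\<close>.\<close>

lemma cond_path_law_eq:
  assumes st: "s \<in> I" "t \<in> I" "T \<in> I" "s \<le> t" "t \<le> T" and x: "x \<notin> A s"
  shows "cond_path_law I \<E> X P A s x t T = path_law s t x (\<lambda>y. S t T y / S s T x)"
proof (rule measure_eqI)
  show "sets (cond_path_law I \<E> X P A s x t T) = sets (path_law s t x (\<lambda>y. S t T y / S s T x))"
    by (simp add: cond_path_law_def path_law_def)
  fix B assume "B \<in> sets (cond_path_law I \<E> X P A s x t T)"
  then have B: "B \<in> sets (PiM (I \<inter> {s..t}) (\<lambda>_. \<E>))" by (simp add: cond_path_law_def)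
  have pos: "0 < S s T x" using st x by (intro S_pos) auto
  let ?c = "ennreal (S s T x)"
  let ?g = "\<lambda>\<omega>. indicator B (path s t \<omega>) :: ennreal"
  have sT: "surv s T \<in> sets (P s x)" using st sets_surv_future by (simp add: sets_P)
  have eS: "emeasure (P s x) (surv s T) = ?c"
    using finite_measure.emeasure_eq_measure[OF prob_space.finite_measure[OF prob_space_P]] st by (simp add: S_def)
  have g: "?g \<in> borel_measurable (past s t)"
    using B by (intro measurable_compose[OF measurable_path]) auto
  have [measurable]: "?g \<in> borel_measurable (P s x)" "surv s T \<in> sets (P s x)"
    using st sT measurable_P[OF st(1) past_future[OF order_refl g]] by auto
  have S [measurable]: "S t T \<in> borel_measurable \<E>" using st by (intro S_measurable)
  have mw: "(\<lambda>y. ennreal (S t T y / S s T x)) \<in> borel_measurable \<E>" by measurable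
  have "emeasure (cond_path_law I \<E> X P A s x t T) B =
    (\<integral>\<^sup>+y. indicator B y \<partial>cond_path_law I \<E> X P A s x t T)"
    using B by (simp add: cond_path_law_def)
  also have "\<dots> = (\<integral>\<^sup>+\<omega>. ?g \<omega> \<partial>uniform_measure (P s x) (surv s T))"
  proof -
    have "path s t \<in> uniform_measure (P s x) (surv s T) \<rightarrow>\<^sub>M PiM (I \<inter> {s..t}) (\<lambda>_. \<E>)"
      using measurable_path_P[OF st(1), of t x] by (simp cong: measurable_cong_sets)
    then show ?thesis using B
      unfolding cond_path_law_def by (subst nn_integral_distr) (auto simp: surv_def space_P st)
  qed
  also have "\<dots> = (\<integral>\<^sup>+\<omega>. ?g \<omega> * (indicator (surv s T) \<omega> * 1) / ?c \<partial>P s x)"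
    unfolding uniform_measure_def eS
    by (subst nn_integral_density) (auto simp: divide_ennreal_def mult_ac intro!: nn_integral_cong)
  also have "\<dots> = (\<integral>\<^sup>+\<omega>. ?g \<omega> * (indicator (surv s T) \<omega> * 1) \<partial>P s x) / ?c"
    by (rule nn_integral_divide) measurable
  also have "(\<integral>\<^sup>+\<omega>. ?g \<omega> * (indicator (surv s T) \<omega> * 1) \<partial>P s x) =
      (\<integral>\<^sup>+\<omega>. ?g \<omega> * (indicator (surv s t) \<omega> * W t T (\<lambda>_. 1) (X t \<omega>)) \<partial>P s x)"
    by (rule W_weight[OF st borel_measurable_const g, symmetric])
  also have "\<dots> = (\<integral>\<^sup>+\<omega>. ?g \<omega> * (indicator (surv s t) \<omega> * ennreal (S t T (X t \<omega>))) \<partial>P s x)"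
    using st by (simp add: W_one)
  also have "\<dots> / ?c = (\<integral>\<^sup>+\<omega>. ?g \<omega> * (indicator (surv s t) \<omega> * ennreal (S t T (X t \<omega>))) / ?c \<partial>P s x)"
  proof (rule nn_integral_divide[symmetric])
    have [measurable]: "(\<lambda>\<omega>. indicator (surv s t) \<omega> * ennreal (S t T (X t \<omega>))) \<in> borel_measurable (P s x)"
      using st S by (intro measurable_P past_future[OF order_refl measurable_surv_X]) auto
    show "(\<lambda>\<omega>. ?g \<omega> * (indicator (surv s t) \<omega> * ennreal (S t T (X t \<omega>)))) \<in> borel_measurable (P s x)"
      by measurable
  qed
  also have "\<dots> = (\<integral>\<^sup>+\<omega>. ?g \<omega> * (indicator (surv s t) \<omega> * ennreal (S t T (X t \<omega>) / S s T x)) \<partial>P s x)"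
    using pos by (simp add: divide_ennreal[symmetric] S_nonneg divide_ennreal_def mult_ac)
  also have "\<dots> = (\<integral>\<^sup>+y. indicator B y \<partial>path_law s t x (\<lambda>y. S t T y / S s T x))"
    using B S st by (intro nn_integral_path_law[symmetric]) auto
  also have "\<dots> = emeasure (path_law s t x (\<lambda>y. S t T y / S s T x)) B"
    using B by (simp add: path_law_def)
  finally show "emeasure (cond_path_law I \<E> X P A s x t T) B = emeasure (path_law s t x (\<lambda>y. S t T y / S s T x)) B" .
qed

lemma prob_space_cond_path_law:
  assumes st: "s \<in> I" "t \<in> I" "T \<in> I" "s \<le> t" "t \<le> T" and x: "x \<notin> A s"
  shows "prob_space (cond_path_law I \<E> X P A s x t T)"
proof -
  have pos: "0 < S s T x" using st x by (intro S_pos) auto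
  have sT: "surv s T \<in> sets (P s x)" using st sets_surv_future by (simp add: sets_P)
  have "emeasure (P s x) (surv s T) = ennreal (S s T x)"
    using finite_measure.emeasure_eq_measure[OF prob_space.finite_measure[OF prob_space_P]] st by (simp add: S_def)
  then have "prob_space (uniform_measure (P s x) (surv s T))"
    using pos by (intro prob_space_uniform_measure) auto
  moreover have "path s t \<in> uniform_measure (P s x) (surv s T) \<rightarrow>\<^sub>M PiM (I \<inter> {s..t}) (\<lambda>_. \<E>)"
    using measurable_path_P[OF st(1), of t x] by (simp cong: measurable_cong_sets)
  ultimately have "prob_space (distr (uniform_measure (P s x) (surv s T)) (PiM (I \<inter> {s..t}) (\<lambda>_. \<E>)) (path s t))"
    by (rule prob_space.prob_space_distr)
  then show ?thesis by (simp add: cond_path_law_def surv_def space_P st)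
qed

end

context doeblin_absorbed_process
begin

section \<open>The Doob transform on finite horizons\<close>

definition Q_law :: "real \<Rightarrow> real \<Rightarrow> 'e \<Rightarrow> (real \<Rightarrow> 'e) measure" where
  "Q_law s t x = path_law s t x (\<lambda>y. H t y / H s x)"

lemma H_quotient_measurable: "t \<in> I \<Longrightarrow> (\<lambda>y. H t y / H s x) \<in> borel_measurable \<E>"
  using H_measurable[of t] by measurable

lemma prob_space_Q_law:
  assumes st: "s \<in> I" "t \<in> I" "s \<le> t" and x: "x \<notin> A s"
  shows "prob_space (Q_law s t x)"
  unfolding Q_law_def
proof (rule prob_space_path_law[OF st H_quotient_measurable[OF st(2)]])
  have pos: "0 < H s x" using st x by (intro H_pos)
  have "W s t (\<lambda>y. ennreal (H t y / H s x)) x = W s t (\<lambda>y. ennreal (H t y) / ennreal (H s x)) x"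
    using pos H_pos[OF st(2)] by (intro W_cong[OF st(2,3)]) (simp add: divide_ennreal less_imp_le)
  also have "\<dots> = (\<integral>\<^sup>+\<omega>. indicator (surv s t) \<omega> * ennreal (H t (X t \<omega>)) / ennreal (H s x) \<partial>P s x)"
    unfolding W_def by (simp add: divide_ennreal_def mult_ac)
  also have "\<dots> = W s t (\<lambda>y. ennreal (H t y)) x / ennreal (H s x)"
    unfolding W_def using st H_measurable
    by (intro nn_integral_divide measurable_P[OF st(1) past_future[OF order_refl measurable_surv_X]]) auto
  also have "\<dots> = 1" using pos by (simp add: W_H[OF st x])
  finally show "W s t (\<lambda>y. ennreal (H t y / H s x)) x = 1" .
qed

text \<open>If \<open>T - t \<ge> t0\<close>, the pointwise estimate \<open>H_close\<close> at the
  endpoint is integrated along killed trajectories, once with the test function and once with 1, and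
  \<open>ratio_difference_le\<close> takes care of the normalisation. If \<open>T - t < t0\<close>,
  only the trivial bound 2 is available, and \<open>rate (T - t) \<ge> 1\<close> covers it.\<close>

lemma Q_law_integral_close:
  assumes st: "s \<in> I" "t \<in> I" "T \<in> I" "s \<le> t" "t \<le> T" and x: "x \<notin> A s"
    and f: "f \<in> borel_measurable (PiM (I \<inter> {s..t}) (\<lambda>_. \<E>))"
      "\<And>y. y \<in> space (PiM (I \<inter> {s..t}) (\<lambda>_. \<E>)) \<Longrightarrow> \<bar>f y\<bar> \<le> 1"
  shows "\<bar>(\<integral>y. f y \<partial>cond_path_law I \<E> X P A s x t T) - (\<integral>y. f y \<partial>Q_law s t x)\<bar> \<le> 2 * rate (T - t)"
proof (cases "t0 \<le> T - t")
  case True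
  let ?F = "\<lambda>\<omega>. f (path s t \<omega>)"
  let ?q = "\<lambda>y. S t T y / Z T"
  let ?i = "\<lambda>g h. \<integral>\<omega>. g \<omega> * (indicator (surv s t) \<omega> * h (X t \<omega>)) \<partial>P s x"
  have F: "?F \<in> borel_measurable (P s x)" "\<bar>?F \<omega>\<bar> \<le> 1" for \<omega>
    using measurable_compose[OF measurable_path_P[OF st(1)] f(1)] f(2)[of "path s t \<omega>"]
    by (auto simp: space_PiM space_state)
  have ZT: "0 < Z T" using Z_pos st by simp
  have mS [measurable]: "S t T \<in> borel_measurable \<E>" and mH [measurable]: "H t \<in> borel_measurable \<E>"
    using st S_measurable H_measurable by auto
  have mq: "?q \<in> borel_measurable \<E>" by measurable
  have qc: "\<bar>?q y\<bar> \<le> 1 / Z T" for y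
    using ZT S_le_1[OF st(2), of T y] S_nonneg[of t T y] by (simp add: divide_right_mono)
  from H_bounded[OF st(2)] obtain c where c: "\<forall>y. y \<notin> A t \<longrightarrow> \<bar>H t y\<bar> \<le> c" ..
  have int_q: "integrable (P s x) (\<lambda>\<omega>. g \<omega> * (indicator (surv s t) \<omega> * ?q (X t \<omega>)))"
    if "g \<in> borel_measurable (P s x)" "\<And>\<omega>. \<bar>g \<omega>\<bar> \<le> 1" for g
    using integrable_surv_X[OF st(1,2,4) mq qc that(1)] that(2) by blast
  have int_H: "integrable (P s x) (\<lambda>\<omega>. g \<omega> * (indicator (surv s t) \<omega> * H t (X t \<omega>)))"
    if "g \<in> borel_measurable (P s x)" "\<And>\<omega>. \<bar>g \<omega>\<bar> \<le> 1" for g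
    using integrable_surv_X[OF st(1,2,4) mH, of c g x] c that by blast
  have "(\<integral>y. ?q y \<partial>\<kappa> s t x) = S s T x / Z T" by (simp add: S_kappa[OF st])
  then have a1: "?i (\<lambda>_. 1) ?q = S s T x / Z T"
    unfolding integral_kappa[OF st(1,2,4) mq] mult_1 .
  have b1: "?i (\<lambda>_. 1) (H t) = H s x"
    using H_kappa[OF st(1,2,4) x] unfolding integral_kappa[OF st(1,2,4) mH] mult_1 .
  have close: "\<bar>?i g ?q - ?i g (H t)\<bar> \<le> rate (T - t) * (S s T x / Z T)"
    if g: "g \<in> borel_measurable (P s x)" "\<And>\<omega>. \<bar>g \<omega>\<bar> \<le> 1" for g
  proof -
    have diff: "?i g ?q - ?i g (H t) =
      (\<integral>\<omega>. g \<omega> * (indicator (surv s t) \<omega> * ?q (X t \<omega>)) - g \<omega> * (indicator (surv s t) \<omega> * H t (X t \<omega>)) \<partial>P s x)"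
      using int_q[OF g] int_H[OF g] by (rule Bochner_Integration.integral_diff[symmetric])
    have "\<bar>?i g ?q - ?i g (H t)\<bar> \<le> (\<integral>\<omega>. \<bar>g \<omega> * (indicator (surv s t) \<omega> * ?q (X t \<omega>)) - g \<omega> * (indicator (surv s t) \<omega> * H t (X t \<omega>))\<bar> \<partial>P s x)"
      unfolding diff by (rule integral_abs_bound)
    also have "\<dots> \<le> (\<integral>\<omega>. rate (T - t) * (1 * (indicator (surv s t) \<omega> * ?q (X t \<omega>))) \<partial>P s x)"
    proof (rule integral_mono)
      fix \<omega>
      have d: "\<bar>H t (X t \<omega>) - ?q (X t \<omega>)\<bar> \<le> rate (T - t) * ?q (X t \<omega>)" if "\<omega> \<in> surv s t"
        using surv_not_absorbed[OF st(2,4) that] True st by (intro H_close) auto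
      have "\<bar>g \<omega>\<bar> * \<bar>indicator (surv s t) \<omega> * (?q (X t \<omega>) - H t (X t \<omega>))\<bar> \<le> 1 * (rate (T - t) * (indicator (surv s t) \<omega> * ?q (X t \<omega>)))"
        using g(2)[of \<omega>] d by (intro mult_mono) (auto simp: abs_minus_commute split: split_indicator)
      then show "\<bar>g \<omega> * (indicator (surv s t) \<omega> * ?q (X t \<omega>)) - g \<omega> * (indicator (surv s t) \<omega> * H t (X t \<omega>))\<bar>
          \<le> rate (T - t) * (1 * (indicator (surv s t) \<omega> * ?q (X t \<omega>)))"
        by (simp add: abs_mult[symmetric] right_diff_distrib)
    next
      show "integrable (P s x) (\<lambda>\<omega>. rate (T - t) * (1 * (indicator (surv s t) \<omega> * ?q (X t \<omega>))))"
        by (rule integrable_mult_right[OF int_q]) auto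
      show "integrable (P s x) (\<lambda>\<omega>. \<bar>g \<omega> * (indicator (surv s t) \<omega> * ?q (X t \<omega>)) - g \<omega> * (indicator (surv s t) \<omega> * H t (X t \<omega>))\<bar>)"
        by (rule integrable_abs[OF Bochner_Integration.integrable_diff[OF int_q[OF g] int_H[OF g]]])
    qed
    also have "\<dots> = rate (T - t) * (S s T x / Z T)"
      by (subst integral_mult_right_zero) (simp only: a1)
    finally show ?thesis .
  qed
  have "\<bar>?i ?F (H t)\<bar> \<le> (\<integral>\<omega>. \<bar>?F \<omega> * (indicator (surv s t) \<omega> * H t (X t \<omega>))\<bar> \<partial>P s x)"
    by (rule integral_abs_bound)
  also have "\<dots> \<le> ?i (\<lambda>_. 1) (H t)"
  proof (rule integral_mono)
    fix \<omega>
    have "0 \<le> H t (X t \<omega>)" if "\<omega> \<in> surv s t"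
      using H_pos[OF st(2) surv_not_absorbed[OF st(2,4) that]] by simp
    then show "\<bar>?F \<omega> * (indicator (surv s t) \<omega> * H t (X t \<omega>))\<bar> \<le> 1 * (indicator (surv s t) \<omega> * H t (X t \<omega>))"
      using F(2)[of \<omega>] by (cases "\<omega> \<in> surv s t") (simp_all add: abs_mult mult_left_le_one_le)
    show "integrable (P s x) (\<lambda>\<omega>. \<bar>?F \<omega> * (indicator (surv s t) \<omega> * H t (X t \<omega>))\<bar>)"
      by (rule integrable_abs[OF int_H[OF F]])
    show "integrable (P s x) (\<lambda>\<omega>. 1 * (indicator (surv s t) \<omega> * H t (X t \<omega>)))"
      by (rule int_H) auto
  qed
  finally have bf: "\<bar>?i ?F (H t)\<bar> \<le> H s x" unfolding b1 .
  have pos: "0 < S s T x" "0 < H s x" using st x S_pos H_pos by auto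
  have mq': "(\<lambda>y. S t T y / S s T x) \<in> borel_measurable \<E>" by measurable
  have "(\<integral>y. f y \<partial>cond_path_law I \<E> X P A s x t T) = (\<integral>\<omega>. ?F \<omega> * (indicator (surv s t) \<omega> * (S t T (X t \<omega>) / S s T x)) \<partial>P s x)"
    unfolding cond_path_law_eq[OF st x]
    by (rule integral_path_law[OF st(1,2,4) mq' _ f(1)]) (simp add: S_nonneg)
  also have "\<dots> = (\<integral>\<omega>. ?F \<omega> * (indicator (surv s t) \<omega> * ?q (X t \<omega>)) / (S s T x / Z T) \<partial>P s x)"
    using ZT pos by (simp add: field_simps)
  also have "\<dots> = ?i ?F ?q / (S s T x / Z T)"
    by (rule integral_divide_zero)
  finally have 1: "(\<integral>y. f y \<partial>cond_path_law I \<E> X P A s x t T) = ?i ?F ?q / (S s T x / Z T)" .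
  have "(\<integral>y. f y \<partial>Q_law s t x) = (\<integral>\<omega>. ?F \<omega> * (indicator (surv s t) \<omega> * (H t (X t \<omega>) / H s x)) \<partial>P s x)"
    unfolding Q_law_def
    by (rule integral_path_law[OF st(1,2,4) H_quotient_measurable[OF st(2)] _ f(1)])
      (rule divide_nonneg_pos[OF less_imp_le[OF H_pos[OF st(2)]] pos(2)])
  also have "\<dots> = (\<integral>\<omega>. ?F \<omega> * (indicator (surv s t) \<omega> * H t (X t \<omega>)) / H s x \<partial>P s x)"
    by (simp only: times_divide_eq_right)
  also have "\<dots> = ?i ?F (H t) / H s x"
    by (rule integral_divide_zero)
  finally have 2: "(\<integral>y. f y \<partial>Q_law s t x) = ?i ?F (H t) / H s x" .
  have "\<bar>S s T x / Z T - H s x\<bar> \<le> rate (T - t) * (S s T x / Z T)"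
    using close[of "\<lambda>_. 1"] unfolding a1 b1 by simp
  then show ?thesis
    unfolding 1 2 by (rule ratio_difference_le[OF divide_pos_pos[OF pos(1) ZT] pos(2) close[OF F] _ bf])
next
  case False
  have bound: "\<bar>\<integral>y. f y \<partial>M\<bar> \<le> 1" if "prob_space M" "sets M = sets (PiM (I \<inter> {s..t}) (\<lambda>_. \<E>))" for M
  proof -
    interpret prob_space M by fact
    have "f \<in> borel_measurable M" using f(1) that(2) by (simp cong: measurable_cong_sets)
    then have int: "integrable M f"
      using f(2) sets_eq_imp_space_eq[OF that(2)] by (intro integrable_const_bound[of _ 1]) auto
    have "\<bar>\<integral>y. f y \<partial>M\<bar> \<le> (\<integral>y. \<bar>f y\<bar> \<partial>M)" by (rule integral_abs_bound)
    also have "\<dots> \<le> (\<integral>y. 1 \<partial>M)"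
      using int f(2) sets_eq_imp_space_eq[OF that(2)] by (intro integral_mono) auto
    finally show ?thesis by (simp add: prob_space)
  qed
  \<comment> \<open>The constant \<open>exp (2 * \<gamma>)\<close> in \<open>rate\<close> pays for
    this short range: the total exponent is at least \<open>\<gamma>\<close>.\<close>
  have "\<gamma> / t0 * (T - t) \<le> \<gamma> / t0 * t0" using False gamma t0 by (intro mult_left_mono) auto
  then have "\<gamma> / t0 * (T - t) \<le> \<gamma>" using t0 by simp
  then have "1 \<le> exp (2 * \<gamma> - \<gamma> / t0 * (T - t))" using gamma by simp
  also have "\<dots> \<le> exp (2 * \<gamma> - \<gamma> / t0 * (T - t)) / \<gamma>" using gamma by (simp add: le_divide_eq mult_left_le)
  also have "\<dots> = rate (T - t)" by (simp add: rate_def exp_diff exp_minus field_simps)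
  finally have "1 \<le> rate (T - t)" .
  then show ?thesis
    using bound[OF prob_space_cond_path_law[OF st x]] bound[OF prob_space_Q_law[OF st(1,2,4) x]]
    by (simp add: cond_path_law_def Q_law_def path_law_def)
qed

section \<open>Extension to the infinite time horizon\<close>

text \<open>The Doob transform as a measure on the original space, with finite horizon
  \<open>t\<close>. Its density with respect to \<open>P s x\<close> has no analogue for the
  infinite horizon, since absorption is certain under \<open>P s x\<close>.\<close>

definition tilt :: "real \<Rightarrow> real \<Rightarrow> 'e \<Rightarrow> 'w measure" where
  "tilt s t x = density (P s x) (\<lambda>\<omega>. indicator (surv s t) \<omega> * ennreal (H t (X t \<omega>)) / ennreal (H s x))"

lemma sets_tilt: "s \<in> I \<Longrightarrow> sets (tilt s t x) = sets (future s)"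
  by (simp add: tilt_def sets_P)

lemma space_tilt: "s \<in> I \<Longrightarrow> space (tilt s t x) = \<Omega>"
  by (simp add: tilt_def space_P)

lemma measurable_tilt: "s \<in> I \<Longrightarrow> f \<in> future s \<rightarrow>\<^sub>M M \<Longrightarrow> f \<in> tilt s t x \<rightarrow>\<^sub>M M"
  using measurable_cong_sets[OF sets_tilt refl] by blast

lemma ennreal_H_measurable: "t \<in> I \<Longrightarrow> (\<lambda>y. ennreal (H t y)) \<in> borel_measurable \<E>"
  by (rule measurable_compose[OF H_measurable measurable_ennreal])

lemma measurable_surv_H:
  "s \<in> I \<Longrightarrow> t \<in> I \<Longrightarrow> s \<le> t \<Longrightarrow> (\<lambda>\<omega>. indicator (surv s t) \<omega> * ennreal (H t (X t \<omega>))) \<in> borel_measurable (past s t)"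
  by (intro measurable_surv_X ennreal_H_measurable)

lemma tilt_weight_measurable:
  assumes "s \<in> I" "t \<in> I" "s \<le> t"
  shows "(\<lambda>\<omega>. indicator (surv s t) \<omega> * ennreal (H t (X t \<omega>)) / ennreal (H s x)) \<in> borel_measurable (P s x)"
  by (intro borel_measurable_divide_ennreal borel_measurable_const measurable_P past_future[OF order_refl measurable_surv_H] assms)

lemma nn_integral_tilt:
  assumes st: "s \<in> I" "t \<in> I" "s \<le> t" and f: "f \<in> borel_measurable (future s)"
  shows "(\<integral>\<^sup>+\<omega>. f \<omega> \<partial>tilt s t x) =
    (\<integral>\<^sup>+\<omega>. f \<omega> * (indicator (surv s t) \<omega> * ennreal (H t (X t \<omega>))) \<partial>P s x) / ennreal (H s x)"
proof -
  have [measurable]: "f \<in> borel_measurable (P s x)"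
    "(\<lambda>\<omega>. indicator (surv s t) \<omega> * ennreal (H t (X t \<omega>))) \<in> borel_measurable (P s x)"
    using st f by (auto intro!: measurable_P past_future[OF order_refl measurable_surv_H])
  have "(\<integral>\<^sup>+\<omega>. f \<omega> \<partial>tilt s t x) =
    (\<integral>\<^sup>+\<omega>. f \<omega> * (indicator (surv s t) \<omega> * ennreal (H t (X t \<omega>))) / ennreal (H s x) \<partial>P s x)"
    unfolding tilt_def using tilt_weight_measurable[OF st]
    by (subst nn_integral_density) (simp_all add: divide_ennreal_def mult_ac)
  also have "\<dots> = (\<integral>\<^sup>+\<omega>. f \<omega> * (indicator (surv s t) \<omega> * ennreal (H t (X t \<omega>))) \<partial>P s x) / ennreal (H s x)"
    by (rule nn_integral_divide) measurable
  finally show ?thesis .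
qed

lemma AE_tilt:
  assumes st: "s \<in> I" "t \<in> I" "s \<le> t"
  shows "AE \<omega> in tilt s t x. \<omega> \<in> surv s t"
  unfolding tilt_def AE_density[OF tilt_weight_measurable[OF st]]
  by (rule AE_I2) (auto simp: indicator_def split: if_splits)

text \<open>Consistency of the horizons: under \<open>P s x\<close> the weights form a martingale,
  as \<open>W t T\<close> maps \<open>H T\<close> to \<open>H t\<close> off
  \<open>A t\<close>.\<close>

lemma tilt_past:
  assumes st: "s \<in> I" "t \<in> I" "T \<in> I" "s \<le> t" "t \<le> T" and f: "f \<in> borel_measurable (past s t)"
  shows "(\<integral>\<^sup>+\<omega>. f \<omega> \<partial>tilt s T x) = (\<integral>\<^sup>+\<omega>. f \<omega> \<partial>tilt s t x)"
proof -
  have f': "f \<in> borel_measurable (future s)" by (rule past_future[OF order_refl f])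
  have sT: "s \<le> T" using st by simp
  have "(\<integral>\<^sup>+\<omega>. f \<omega> * (indicator (surv s T) \<omega> * ennreal (H T (X T \<omega>))) \<partial>P s x) =
    (\<integral>\<^sup>+\<omega>. f \<omega> * (indicator (surv s t) \<omega> * W t T (\<lambda>y. ennreal (H T y)) (X t \<omega>)) \<partial>P s x)"
    by (rule W_weight[OF st ennreal_H_measurable[OF st(3)] f, symmetric])
  also have "\<dots> = (\<integral>\<^sup>+\<omega>. f \<omega> * (indicator (surv s t) \<omega> * ennreal (H t (X t \<omega>))) \<partial>P s x)"
    using W_H[OF st(2,3,5)] surv_not_absorbed[OF st(2,4)]
    by (intro nn_integral_cong) (auto split: split_indicator)
  finally show ?thesis
    by (simp only: nn_integral_tilt[OF st(1,2,4) f'] nn_integral_tilt[OF st(1,3) sT f'])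
qed

lemma prob_space_tilt:
  assumes st: "s \<in> I" "t \<in> I" "s \<le> t" and x: "x \<notin> A s"
  shows "prob_space (tilt s t x)"
proof
  have "emeasure (tilt s t x) (space (tilt s t x)) = (\<integral>\<^sup>+\<omega>. 1 \<partial>tilt s t x)" by simp
  also have "\<dots> = W s t (\<lambda>y. ennreal (H t y)) x / ennreal (H s x)"
    by (subst nn_integral_tilt[OF st]) (simp_all add: W_def)
  also have "\<dots> = 1" using H_pos[OF st(1) x] by (simp add: W_H[OF st x])
  finally show "emeasure (tilt s t x) (space (tilt s t x)) = 1" .
qed

text \<open>The tilted process is again Markov: the divisor \<open>H t (X t \<omega>)\<close> of the
  second piece cancels the weight of the first, being positive and finite on survival up to
  \<open>t\<close>.\<close>

lemma tilt_pair:
  assumes st: "s \<in> I" "t \<in> I" "T \<in> I" "s \<le> t" "t \<le> T"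
    and f: "case_prod f \<in> borel_measurable (past s t \<Otimes>\<^sub>M past t T)"
  shows "(\<integral>\<^sup>+\<omega>. f \<omega> \<omega> \<partial>tilt s T x) = (\<integral>\<^sup>+\<omega>. (\<integral>\<^sup>+\<omega>'. f \<omega> \<omega>' \<partial>tilt t T (X t \<omega>)) \<partial>tilt s t x)"
proof -
  let ?h = "\<lambda>\<omega>'. indicator (surv t T) \<omega>' * ennreal (H T (X T \<omega>'))"
  let ?inner = "\<lambda>\<omega>. \<integral>\<^sup>+\<omega>'. f \<omega> \<omega>' * ?h \<omega>' \<partial>P t (X t \<omega>)"
  have sT: "s \<le> T" using st by simp
  have fut: "(\<lambda>\<omega>. \<omega>) \<in> future t \<rightarrow>\<^sub>M past t T" by (rule measurable_ident_natural_sigma) auto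
  have f1 [measurable]: "(\<lambda>p. f (fst p) (snd p)) \<in> borel_measurable (past s t \<Otimes>\<^sub>M future t)"
    using measurable_compose[OF measurable_Pair[OF measurable_fst measurable_compose[OF measurable_snd fut]] f]
    by simp
  have f2: "f \<omega> \<in> borel_measurable (future t)" if "\<omega> \<in> \<Omega>" for \<omega>
    using measurable_compose[OF measurable_Pair1'[of \<omega> "past s t"] f1] that by simp
  have f3: "(\<lambda>\<omega>. f \<omega> \<omega>) \<in> borel_measurable (future s)"
  proof -
    have "(\<lambda>\<omega>. (\<omega>, \<omega>)) \<in> future s \<rightarrow>\<^sub>M past s t \<Otimes>\<^sub>M past t T"
      by (intro measurable_Pair measurable_ident_natural_sigma) (use st in auto)
    from measurable_compose[OF this f] show ?thesis by simp
  qed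
  have [measurable]: "?h \<in> borel_measurable (future t)"
    by (intro past_future[OF order_refl measurable_surv_H] st)
  have Xt: "X t \<in> past s t \<rightarrow>\<^sub>M \<E>" using st by (intro measurable_X) auto
  have inner: "?inner \<in> borel_measurable (past s t)"
  proof (rule nn_integral_measurable_subprob_algebra2)
    show "(\<lambda>(\<omega>, \<omega>'). f \<omega> \<omega>' * ?h \<omega>') \<in> borel_measurable (past s t \<Otimes>\<^sub>M future t)"
      unfolding split_beta' by measurable
    show "(\<lambda>\<omega>. P t (X t \<omega>)) \<in> past s t \<rightarrow>\<^sub>M subprob_algebra (future t)"
      by (rule measurable_compose[OF Xt subprob_kernel]) (rule st)
  qed
  have "(\<lambda>\<omega>. ?inner \<omega> / ennreal (H t (X t \<omega>))) \<in> borel_measurable (past s t)"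
    by (intro borel_measurable_divide_ennreal inner measurable_compose[OF Xt ennreal_H_measurable] st)
  then have inner_H: "(\<lambda>\<omega>. ?inner \<omega> / ennreal (H t (X t \<omega>))) \<in> borel_measurable (future s)"
    by (rule past_future[OF order_refl])
  have "(\<integral>\<^sup>+\<omega>. (\<integral>\<^sup>+\<omega>'. f \<omega> \<omega>' \<partial>tilt t T (X t \<omega>)) \<partial>tilt s t x) = (\<integral>\<^sup>+\<omega>. ?inner \<omega> / ennreal (H t (X t \<omega>)) \<partial>tilt s t x)"
    by (intro nn_integral_cong nn_integral_tilt st f2) (simp add: space_tilt st)
  also have "\<dots> = (\<integral>\<^sup>+\<omega>. ?inner \<omega> / ennreal (H t (X t \<omega>)) * (indicator (surv s t) \<omega> * ennreal (H t (X t \<omega>))) \<partial>P s x) / ennreal (H s x)"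
    by (rule nn_integral_tilt[OF st(1,2,4) inner_H])
  also have "(\<integral>\<^sup>+\<omega>. ?inner \<omega> / ennreal (H t (X t \<omega>)) * (indicator (surv s t) \<omega> * ennreal (H t (X t \<omega>))) \<partial>P s x) =
    (\<integral>\<^sup>+\<omega>. indicator (surv s t) \<omega> * ?inner \<omega> \<partial>P s x)"
  proof (rule nn_integral_cong)
    fix \<omega>
    show "?inner \<omega> / ennreal (H t (X t \<omega>)) * (indicator (surv s t) \<omega> * ennreal (H t (X t \<omega>))) = indicator (surv s t) \<omega> * ?inner \<omega>"
      using H_pos[OF st(2), of "X t \<omega>"] surv_not_absorbed[OF st(2,4), of \<omega>]
      by (cases "\<omega> \<in> surv s t") (simp_all add: ennreal_divide_times divide_mult_eq)
  qed
  also have "\<dots> = (\<integral>\<^sup>+\<omega>. f \<omega> \<omega> * (indicator (surv s T) \<omega> * ennreal (H T (X T \<omega>))) \<partial>P s x)"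
    by (rule W_pair[OF st ennreal_H_measurable[OF st(3)] f])
  also have "\<dots> / ennreal (H s x) = (\<integral>\<^sup>+\<omega>. f \<omega> \<omega> \<partial>tilt s T x)"
    by (rule nn_integral_tilt[OF st(1,3) sT f3, symmetric])
  finally show ?thesis ..
qed

lemma Q_law_tilt:
  assumes st: "s \<in> I" "t \<in> I" "s \<le> t" and x: "x \<notin> A s"
  shows "Q_law s t x = distr (tilt s t x) (PiM (I \<inter> {s..t}) (\<lambda>_. \<E>)) (path s t)"
proof -
  have "indicator (surv s t) \<omega> * ennreal (H t (X t \<omega>)) / ennreal (H s x) =
      indicator (surv s t) \<omega> * ennreal (H t (X t \<omega>) / H s x)" for \<omega>
    using H_pos[OF st(2), of "X t \<omega>"] surv_not_absorbed[OF st(2,3), of \<omega>] H_pos[OF st(1) x]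
    by (cases "\<omega> \<in> surv s t") (simp_all add: divide_ennreal)
  then show ?thesis by (simp add: Q_law_def path_law_def tilt_def)
qed

text \<open>The path space of the \<open>Q\<close>-process is cut into the segments \<open>(s + n - 1, s + n]\<close>; half-open
  segments are disjoint, so that no compatibility at common endpoints has to be checked.\<close>

definition seg_times :: "real \<Rightarrow> nat \<Rightarrow> real set" where
  "seg_times s n = {u\<in>I. s \<le> u \<and> s + real n - 1 < u \<and> u \<le> s + real n}"

definition seg_space :: "real \<Rightarrow> nat \<Rightarrow> (real \<Rightarrow> 'e) measure" where
  "seg_space s n = PiM (seg_times s n) (\<lambda>_. \<E>)"

definition seg :: "real \<Rightarrow> nat \<Rightarrow> 'w \<Rightarrow> real \<Rightarrow> 'e" where
  "seg s n \<omega> = (\<lambda>u\<in>seg_times s n. X u \<omega>)"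

definition segs :: "real \<Rightarrow> nat \<Rightarrow> 'w \<Rightarrow> nat \<Rightarrow> real \<Rightarrow> 'e" where
  "segs s m \<omega> = (\<lambda>i\<in>{0..<m}. seg s i \<omega>)"

text \<open>The Ionescu-Tulcea theorem demands a probability kernel from every state. On
  \<open>A (s + n)\<close> the tilt need not be one, so the untilted law stands in; the tilted
  process almost surely never takes that branch.\<close>

definition seg_kernel :: "real \<Rightarrow> nat \<Rightarrow> 'e \<Rightarrow> (real \<Rightarrow> 'e) measure" where
  "seg_kernel s n y = distr (if y \<in> A (s + real n) then P (s + real n) y else tilt (s + real n) (s + real (Suc n)) y)
     (seg_space s (Suc n)) (seg s (Suc n))"

text \<open>Segment 0 is the single time \<open>s\<close>. The right endpoint \<open>s + n\<close>
  belongs to segment \<open>n\<close>, so the next kernel can read the current state there.\<close>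

primrec path_kernel :: "real \<Rightarrow> 'e \<Rightarrow> nat \<Rightarrow> (nat \<Rightarrow> real \<Rightarrow> 'e) \<Rightarrow> (real \<Rightarrow> 'e) measure" where
  "path_kernel s x 0 = (\<lambda>_. distr (tilt s s x) (seg_space s 0) (seg s 0))"
| "path_kernel s x (Suc n) = (\<lambda>w. seg_kernel s n (w n (s + real n)))"

lemma measurable_seg:
  "seg_times s n \<subseteq> J \<Longrightarrow> seg s n \<in> natural_sigma \<Omega> \<E> X J \<rightarrow>\<^sub>M seg_space s n"
  unfolding seg_def[abs_def] seg_space_def by (intro measurable_restrict measurable_X) auto

lemma measurable_seg_past: "r \<le> s + real n \<Longrightarrow> s + real (Suc n) \<le> T \<Longrightarrow> seg s (Suc n) \<in> past r T \<rightarrow>\<^sub>M seg_space s (Suc n)"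
  by (rule measurable_seg) (auto simp: seg_times_def)

lemma measurable_segs: "s + real n \<le> T \<Longrightarrow> segs s (Suc n) \<in> past s T \<rightarrow>\<^sub>M PiM {0..<Suc n} (seg_space s)"
  unfolding segs_def[abs_def]
  by (intro measurable_restrict measurable_seg) (auto simp: seg_times_def)

lemma seg_kernel_measurable:
  assumes s: "s \<in> I"
  shows "seg_kernel s n \<in> \<E> \<rightarrow>\<^sub>M subprob_algebra (seg_space s (Suc n))"
    and "prob_space (seg_kernel s n y)"
proof -
  let ?t = "s + real n" and ?T = "s + real (Suc n)"
  have tT: "?t \<in> I" "?T \<in> I" "?t \<le> ?T"
    by (rule time_add[OF s time_of_nat], rule time_add[OF s time_of_nat], simp)
  have sm: "seg s (Suc n) \<in> future ?t \<rightarrow>\<^sub>M seg_space s (Suc n)"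
    by (rule past_future[OF order_refl measurable_seg_past]) auto
  show p: "prob_space (seg_kernel s n y)" for y
    unfolding seg_kernel_def using sm tT
    by (intro prob_space.prob_space_distr) (auto intro: prob_space_P prob_space_tilt measurable_P measurable_tilt)
  show "seg_kernel s n \<in> \<E> \<rightarrow>\<^sub>M subprob_algebra (seg_space s (Suc n))"
  proof (rule measurable_subprob_algebra)
    show "subprob_space (seg_kernel s n y)" for y using p by (rule prob_space_imp_subprob_space)
    show "sets (seg_kernel s n y) = sets (seg_space s (Suc n))" for y by (simp add: seg_kernel_def)
    fix B assume B [measurable]: "B \<in> sets (seg_space s (Suc n))"
    let ?g = "\<lambda>\<omega>. indicator B (seg s (Suc n) \<omega>) :: ennreal"
    \<comment> \<open>Measurability in \<open>y\<close> is read off from an explicit formula, with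
      the divisor \<open>H ?t y\<close> outside the integral.\<close>
    let ?f = "\<lambda>y. if y \<in> A ?t then \<integral>\<^sup>+\<omega>. ?g \<omega> \<partial>P ?t y else
      (\<integral>\<^sup>+\<omega>. ?g \<omega> * (indicator (surv ?t ?T) \<omega> * ennreal (H ?T (X ?T \<omega>))) \<partial>P ?t y) / ennreal (H ?t y)"
    have g [measurable]: "?g \<in> borel_measurable (future ?t)"
      by (rule measurable_compose[OF sm]) measurable
    have eq: "emeasure (seg_kernel s n y) B = ?f y" for y
    proof -
      have "emeasure (seg_kernel s n y) B = (\<integral>\<^sup>+w. indicator B w \<partial>seg_kernel s n y)"
        using B by (simp add: seg_kernel_def)
      also have "\<dots> = (\<integral>\<^sup>+\<omega>. ?g \<omega> \<partial>(if y \<in> A ?t then P ?t y else tilt ?t ?T y))"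
        unfolding seg_kernel_def using sm tT
        by (intro nn_integral_distr) (auto intro: measurable_P measurable_tilt)
      finally show ?thesis using nn_integral_tilt[OF tT g] by simp
    qed
    have m: "(\<lambda>y. \<integral>\<^sup>+\<omega>. ?g \<omega> \<partial>P ?t y) \<in> borel_measurable \<E>"
      by (rule measurable_nn_integral_P[OF tT(1) g])
    have "(\<lambda>\<omega>. ?g \<omega> * (indicator (surv ?t ?T) \<omega> * ennreal (H ?T (X ?T \<omega>)))) \<in> borel_measurable (future ?t)"
      using past_future[OF order_refl measurable_surv_H[OF tT]] by measurable
    then have m': "(\<lambda>y. (\<integral>\<^sup>+\<omega>. ?g \<omega> * (indicator (surv ?t ?T) \<omega> * ennreal (H ?T (X ?T \<omega>))) \<partial>P ?t y) / ennreal (H ?t y)) \<in> borel_measurable \<E>"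
      by (intro borel_measurable_divide_ennreal measurable_nn_integral_P ennreal_H_measurable tT)
    show "(\<lambda>y. emeasure (seg_kernel s n y) B) \<in> borel_measurable \<E>"
      unfolding eq using absorbing_sets[OF tT(1)]
      by (intro measurable_If_set m m') (simp add: space_state)
  qed
qed

section \<open>Joining the segments on path space\<close>

lemma Ionescu_Tulcea_path_kernel:
  assumes s: "s \<in> I" and x: "x \<notin> A s"
  shows "Ionescu_Tulcea (path_kernel s x) (seg_space s)"
proof (rule Ionescu_Tulcea.intro)
  have seg0: "seg s 0 \<in> tilt s s x \<rightarrow>\<^sub>M seg_space s 0"
    by (intro measurable_tilt[OF s] measurable_seg) (auto simp: seg_times_def)
  have p0: "prob_space (distr (tilt s s x) (seg_space s 0) (seg s 0))"
    by (intro prob_space.prob_space_distr prob_space_tilt s x seg0) simp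
  show "path_kernel s x i \<in> PiM {0..<i} (seg_space s) \<rightarrow>\<^sub>M subprob_algebra (seg_space s i)" for i
  proof (cases i)
    case 0
    then show ?thesis
      using p0 by (auto intro!: measurable_const simp: space_subprob_algebra prob_space_imp_subprob_space)
  next
    case (Suc n)
    have "s + real n \<in> seg_times s n"
      using time_add[OF s time_of_nat] by (simp add: seg_times_def)
    then have "(\<lambda>w. w n (s + real n)) \<in> PiM {0..<i} (seg_space s) \<rightarrow>\<^sub>M \<E>"
      using Suc unfolding seg_space_def
      by (intro measurable_compose[OF measurable_component_singleton[of n] measurable_component_singleton]) auto
    from measurable_compose[OF this seg_kernel_measurable(1)[OF s]] show ?thesis
      using Suc by simp
  qed
  show "prob_space (path_kernel s x i w)" if "w \<in> space (PiM {0..<i} (seg_space s))" for i w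
    using p0 seg_kernel_measurable(2)[OF s] by (cases i) auto
qed

lemma segs_update: "(segs s n \<omega>)(n := seg s n \<omega>) = segs s (Suc n) \<omega>"
  by (auto simp: segs_def fun_eq_iff less_Suc_eq)

lemma seg_last: "s \<in> I \<Longrightarrow> segs s (Suc n) \<omega> n (s + real n) = X (s + real n) \<omega>"
  using time_add[OF _ time_of_nat, of s n] by (simp add: segs_def seg_def seg_times_def)

text \<open>Induction on the number of segments. The kernels draw each new segment from the state at
  the end of the previous one; by \<open>tilt_pair\<close> at time \<open>s + n\<close> this agrees
  with running the tilted process in one go up to \<open>s + n + 1\<close>.\<close>

lemma Ionescu_Tulcea_marginal:
  assumes s: "s \<in> I" and x: "x \<notin> A s"
  shows "Ionescu_Tulcea.C (path_kernel s x) (seg_space s) 0 (Suc n) (\<lambda>_. undefined) =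
    distr (tilt s (s + real n) x) (PiM {0..<Suc n} (seg_space s)) (segs s (Suc n))"
proof -
  interpret IT: Ionescu_Tulcea "path_kernel s x" "seg_space s"
    by (rule Ionescu_Tulcea_path_kernel) fact+
  let ?u = "\<lambda>_::nat. undefined :: real \<Rightarrow> 'e"
  have u: "?u \<in> space (PiM {0..<0} (seg_space s))" by simp
  have segs_m: "segs s (Suc n) \<in> tilt s T x \<rightarrow>\<^sub>M PiM {0..<Suc n} (seg_space s)" for n T
    by (intro measurable_tilt[OF s] past_future[OF order_refl measurable_segs[OF order_refl]])
  show ?thesis
  proof (induction n)
    case 0
    have seg0: "seg s 0 \<in> tilt s s x \<rightarrow>\<^sub>M seg_space s 0"
      by (intro measurable_tilt[OF s] measurable_seg) (auto simp: seg_times_def)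
    have upd: "fun_upd ?u 0 \<in> seg_space s 0 \<rightarrow>\<^sub>M PiM {0..<Suc 0} (seg_space s)"
      by (rule measurable_fun_upd[where J = "{0..<0}"]) auto
    have "IT.C 0 (Suc 0) ?u = IT.eP 0 ?u"
      using bind_return[OF IT.measurable_eP[of 0] u] by simp
    also have "\<dots> = distr (tilt s s x) (PiM {0..<Suc 0} (seg_space s)) (fun_upd ?u 0 \<circ> seg s 0)"
      unfolding IT.eP_def path_kernel.simps by (rule distr_distr[OF upd seg0])
    also have "fun_upd ?u 0 \<circ> seg s 0 = segs s (Suc 0)"
      by (auto simp: fun_eq_iff segs_def)
    finally show ?case by simp
  next
    case (Suc n)
    let ?t = "s + real n" and ?T = "s + real (Suc n)"
    have tT: "?t \<in> I" "?T \<in> I" "s \<le> ?t" "?t \<le> ?T"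
      by (rule time_add[OF s time_of_nat], rule time_add[OF s time_of_nat], simp_all)
    let ?D = "distr (tilt s ?t x) (PiM {0..<Suc n} (seg_space s)) (segs s (Suc n))"
    let ?M = "PiM {0..<Suc (Suc n)} (seg_space s)"
    have C: "IT.C 0 (Suc (Suc n)) ?u = ?D \<bind> IT.eP (Suc n)"
      using Suc by simp
    have eP: "IT.eP (Suc n) \<in> ?D \<rightarrow>\<^sub>M subprob_algebra ?M"
      using IT.measurable_eP[of "Suc n"] by simp
    have ne: "space ?D \<noteq> {}"
      using prob_space.not_empty[OF prob_space.prob_space_distr[OF prob_space_tilt[OF s tT(1,3) x] segs_m[of n]]] .
    show ?case
    proof (rule measure_eqI)
      show "sets (IT.C 0 (Suc (Suc n)) ?u) = sets (distr (tilt s ?T x) ?M (segs s (Suc (Suc n))))"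
        unfolding C using sets_bind_measurable[OF eP ne] by simp
      fix B assume "B \<in> sets (IT.C 0 (Suc (Suc n)) ?u)"
      then have B: "B \<in> sets ?M" unfolding C using sets_bind_measurable[OF eP ne] by simp
      have mB [measurable]: "indicator B \<in> borel_measurable ?M" using B by simp
      \<comment> \<open>The first argument supplies segments 0 to \<open>n\<close>, the second one
        segment \<open>n + 1\<close>; on the diagonal they combine by
        \<open>segs_update\<close>.\<close>
      let ?f = "\<lambda>\<omega> \<omega>'. indicator B ((segs s (Suc n) \<omega>)(Suc n := seg s (Suc n) \<omega>')) :: ennreal"
      have upd: "(\<lambda>p. (fst p)(Suc n := snd p)) \<in> PiM {0..<Suc n} (seg_space s) \<Otimes>\<^sub>M seg_space s (Suc n) \<rightarrow>\<^sub>M ?M"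
        using measurable_add_dim[of "Suc n" "{0..<Suc n}" "seg_space s"]
        by (simp add: split_beta' atLeast0_lessThan_Suc)
      have f: "case_prod ?f \<in> borel_measurable (past s ?t \<Otimes>\<^sub>M past ?t ?T)"
        using measurable_compose[OF measurable_Pair[OF measurable_compose[OF measurable_fst measurable_segs[OF order_refl]]
            measurable_compose[OF measurable_snd measurable_seg_past[OF order_refl order_refl]]] measurable_compose[OF upd mB]]
        by (simp add: split_beta')
      have eP_B: "(\<lambda>w. emeasure (IT.eP (Suc n) w) B) \<in> borel_measurable (PiM {0..<Suc n} (seg_space s))"
        by (rule measurable_compose[OF IT.measurable_eP measurable_emeasure_subprob_algebra[OF B]])
      have "emeasure (IT.C 0 (Suc (Suc n)) ?u) B = (\<integral>\<^sup>+w. emeasure (IT.eP (Suc n) w) B \<partial>?D)"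
        unfolding C by (rule emeasure_bind[OF ne eP B])
      also have "\<dots> = (\<integral>\<^sup>+\<omega>. emeasure (IT.eP (Suc n) (segs s (Suc n) \<omega>)) B \<partial>tilt s ?t x)"
        by (rule nn_integral_distr[OF segs_m]) (use eP_B in simp)
      also have "\<dots> = (\<integral>\<^sup>+\<omega>. (\<integral>\<^sup>+\<omega>'. ?f \<omega> \<omega>' \<partial>tilt ?t ?T (X ?t \<omega>)) \<partial>tilt s ?t x)"
      \<comment> \<open>Equality holds on survival, where \<open>X ?t \<omega>\<close> lies off
        \<open>A ?t\<close> and \<open>seg_kernel\<close> takes its tilted branch; by
        \<open>AE_tilt\<close> this is almost everywhere.\<close>
      proof (rule nn_integral_cong_AE, use AE_tilt[OF s tT(1,3)] AE_space in eventually_elim)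
        fix \<omega> assume sv: "\<omega> \<in> surv s ?t" and sp: "\<omega> \<in> space (tilt s ?t x)"
        have w: "segs s (Suc n) \<omega> \<in> space (PiM {0..<Suc n} (seg_space s))"
          using measurable_space[OF segs_m sp] .
        have na: "X ?t \<omega> \<notin> A ?t" by (rule surv_not_absorbed[OF tT(1,3) sv])
        have sm: "seg s (Suc n) \<in> tilt ?t ?T (X ?t \<omega>) \<rightarrow>\<^sub>M seg_space s (Suc n)"
          by (intro measurable_tilt tT past_future[OF order_refl measurable_seg_past]) auto
        have mf: "(\<lambda>v. indicator B ((segs s (Suc n) \<omega>)(Suc n := v)) :: ennreal) \<in> borel_measurable (seg_space s (Suc n))"
          using measurable_compose[OF measurable_Pair1'[OF w] measurable_compose[OF upd mB]] by simp
        have "emeasure (IT.eP (Suc n) (segs s (Suc n) \<omega>)) B = (\<integral>\<^sup>+v. indicator B v \<partial>IT.eP (Suc n) (segs s (Suc n) \<omega>))"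
          using B IT.sets_eP[OF w] by simp
        also have "\<dots> = (\<integral>\<^sup>+v. indicator B ((segs s (Suc n) \<omega>)(Suc n := v)) \<partial>path_kernel s x (Suc n) (segs s (Suc n) \<omega>))"
          by (rule IT.nn_integral_eP[OF w mB])
        also have "path_kernel s x (Suc n) (segs s (Suc n) \<omega>) = distr (tilt ?t ?T (X ?t \<omega>)) (seg_space s (Suc n)) (seg s (Suc n))"
          using na by (simp add: seg_last[OF s] seg_kernel_def)
        also have "(\<integral>\<^sup>+v. indicator B ((segs s (Suc n) \<omega>)(Suc n := v)) \<partial>distr (tilt ?t ?T (X ?t \<omega>)) (seg_space s (Suc n)) (seg s (Suc n)))
            = (\<integral>\<^sup>+\<omega>'. ?f \<omega> \<omega>' \<partial>tilt ?t ?T (X ?t \<omega>))"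
          by (rule nn_integral_distr[OF sm]) (use mf in simp)
        finally show "emeasure (IT.eP (Suc n) (segs s (Suc n) \<omega>)) B = (\<integral>\<^sup>+\<omega>'. ?f \<omega> \<omega>' \<partial>tilt ?t ?T (X ?t \<omega>))" .
      qed
      also have "\<dots> = (\<integral>\<^sup>+\<omega>. ?f \<omega> \<omega> \<partial>tilt s ?T x)"
        by (rule tilt_pair[OF s tT f, symmetric])
      also have "\<dots> = (\<integral>\<^sup>+\<omega>. indicator B (segs s (Suc (Suc n)) \<omega>) \<partial>tilt s ?T x)"
        by (simp only: segs_update)
      also have "\<dots> = (\<integral>\<^sup>+w. indicator B w \<partial>distr (tilt s ?T x) ?M (segs s (Suc (Suc n))))"
        by (rule nn_integral_distr[OF segs_m, symmetric]) (use mB in simp)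
      also have "\<dots> = emeasure (distr (tilt s ?T x) ?M (segs s (Suc (Suc n)))) B"
        using B by simp
      finally show "emeasure (IT.C 0 (Suc (Suc n)) ?u) B = emeasure (distr (tilt s ?T x) ?M (segs s (Suc (Suc n)))) B" .
    qed
  qed
qed

text \<open>The Ionescu-Tulcea limit is a law on sequences of segments, and gluing them gives a law
  on paths. The restriction of a path to [s,t] involves finitely many segments, so
  \<open>Ionescu_Tulcea_marginal\<close> identifies its law.\<close>

lemma Q_law_extension:
  assumes s: "s \<in> I" and x: "x \<notin> A s"
  shows "\<exists>R \<in> space (prob_algebra (PiM (I \<inter> {s..}) (\<lambda>_. \<E>))).
    \<forall>t\<in>I. s \<le> t \<longrightarrow> path_marginal I \<E> R s t = Q_law s t x"
proof -
  interpret IT: Ionescu_Tulcea "path_kernel s x" "seg_space s"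
    by (rule Ionescu_Tulcea_path_kernel) fact+
  \<comment> \<open>Segment \<open>k\<close> reaches from \<open>s + k - 1\<close>, excluded, to
    \<open>s + k\<close>, included, hence the ceiling; \<open>u = s\<close> gets index 0.\<close>
  define idx where "idx u = nat \<lceil>u - s\<rceil>" for u
  define glue where "glue J w = (\<lambda>u\<in>J. w (idx u) u)" for J :: "real set" and w :: "nat \<Rightarrow> real \<Rightarrow> 'e"
  have idx: "u \<in> seg_times s (idx u)" if "u \<in> I" "s \<le> u" for u
    using that unfolding seg_times_def idx_def by (simp add: ceiling_correct le_nat_iff) linarith
  have glue_m: "glue J \<in> PiM K (seg_space s) \<rightarrow>\<^sub>M PiM J (\<lambda>_. \<E>)" if "J \<subseteq> I \<inter> {s..}" "idx ` J \<subseteq> K" for J K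
    unfolding glue_def[abs_def]
  proof (rule measurable_restrict)
    fix u assume u: "u \<in> J"
    have "(\<lambda>w. w (idx u)) \<in> PiM K (seg_space s) \<rightarrow>\<^sub>M PiM (seg_times s (idx u)) (\<lambda>_. \<E>)"
      using measurable_component_singleton[of "idx u" K "seg_space s"] u that by (auto simp: seg_space_def)
    moreover have "(\<lambda>v. v u) \<in> PiM (seg_times s (idx u)) (\<lambda>_. \<E>) \<rightarrow>\<^sub>M \<E>"
      using idx[of u] u that(1) by (intro measurable_component_singleton) auto
    ultimately show "(\<lambda>w. w (idx u) u) \<in> PiM K (seg_space s) \<rightarrow>\<^sub>M \<E>"
      by (rule measurable_compose)
  qed
  let ?L = "IT.PF.lim"
  have sets_L: "sets ?L = sets (PiM UNIV (seg_space s))" by simp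
  have lim_m: "f \<in> ?L \<rightarrow>\<^sub>M N" if "f \<in> PiM UNIV (seg_space s) \<rightarrow>\<^sub>M N" for f and N :: "(nat \<Rightarrow> real \<Rightarrow> 'e) measure"
    using that measurable_cong_sets[OF sets_L refl] by blast
  define R where "R = distr ?L (PiM (I \<inter> {s..}) (\<lambda>_. \<E>)) (glue (I \<inter> {s..}))"
  \<comment> \<open>\<open>up_to\<close> is the least strict upper bound of the index set, here
    \<open>n + 1\<close>, and restricting to all indices below it changes nothing. The marginal is
    therefore the law found in \<open>Ionescu_Tulcea_marginal\<close>.\<close>
  have C: "distr ?L (PiM {0..<Suc n} (seg_space s)) (\<lambda>w. restrict w {0..<Suc n}) =
      distr (tilt s (s + real n) x) (PiM {0..<Suc n} (seg_space s)) (segs s (Suc n))" for n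
  proof -
    have "IT.up_to {0..<Suc n} \<le> Suc n" by (subst IT.up_to_iff) auto
    moreover have "Suc n \<le> IT.up_to {0..<Suc n}" using IT.up_to_less[of "{0..<Suc n}" n] by simp
    ultimately have up: "IT.up_to {0..<Suc n} = Suc n" by simp
    let ?C = "IT.C 0 (Suc n) (\<lambda>_. undefined)"
    have "IT.CI {0..<Suc n} = distr ?C (PiM {0..<Suc n} (seg_space s)) (\<lambda>w. restrict w {0..<Suc n})"
      by (simp only: IT.CI_def up)
    also have "\<dots> = distr ?C ?C (\<lambda>w. w)"
    proof (rule distr_cong)
      have sC: "sets ?C = sets (PiM {0..<Suc n} (seg_space s))" using IT.sets_C[of "\<lambda>_. undefined" 0 "Suc n"] by simp
      then show "sets (PiM {0..<Suc n} (seg_space s)) = sets ?C" by simp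
      fix w assume "w \<in> space ?C"
      then have "w \<in> space (PiM {0..<Suc n} (seg_space s))" using sets_eq_imp_space_eq[OF sC] by simp
      then show "restrict w {0..<Suc n} = w" by (auto simp: space_PiM PiE_restrict)
    qed simp
    also have "\<dots> = ?C" by (rule distr_id)
    finally show ?thesis
      using IT.distr_lim[of "{0..<Suc n}"] Ionescu_Tulcea_marginal[OF s x, of n] by simp
  qed
  \<comment> \<open>\<open>?L\<close> has total mass 1 because its image on segment 0 does.\<close>
  have p: "prob_space ?L"
  proof (rule prob_space_distrD)
    show "(\<lambda>w. restrict w {0..<Suc 0}) \<in> ?L \<rightarrow>\<^sub>M PiM {0..<Suc 0} (seg_space s)"
      by (intro lim_m measurable_restrict_subset) simp
    have "segs s (Suc 0) \<in> tilt s (s + real 0) x \<rightarrow>\<^sub>M PiM {0..<Suc 0} (seg_space s)"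
      by (intro measurable_tilt[OF s] past_future[OF order_refl measurable_segs[OF order_refl]])
    then show "prob_space (distr ?L (PiM {0..<Suc 0} (seg_space s)) (\<lambda>w. restrict w {0..<Suc 0}))"
      unfolding C by (intro prob_space.prob_space_distr prob_space_tilt s x) (use s in auto)
  qed
  have glue_L: "glue J \<in> ?L \<rightarrow>\<^sub>M PiM J (\<lambda>_. \<E>)" if "J \<subseteq> I \<inter> {s..}" for J
    using glue_m[OF that, of UNIV] measurable_cong_sets[OF sets_L refl] by blast
  have "R \<in> space (prob_algebra (PiM (I \<inter> {s..}) (\<lambda>_. \<E>)))"
    unfolding R_def space_prob_algebra using prob_space.prob_space_distr[OF p glue_L[OF order_refl]] by simp
  moreover have "path_marginal I \<E> R s t = Q_law s t x" if t: "t \<in> I" "s \<le> t" for t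
  proof -
    let ?J = "I \<inter> {s..t}" and ?n = "idx t"
    let ?D = "PiM {0..<Suc ?n} (seg_space s)" and ?E = "PiM ?J (\<lambda>_. \<E>)"
    have J: "?J \<subseteq> I \<inter> {s..}" by auto
    have idx_le: "idx u \<le> ?n" if "u \<le> t" for u
      unfolding idx_def by (intro nat_mono ceiling_mono) (use that in simp)
    then have idxJ: "idx ` ?J \<subseteq> {0..<Suc ?n}" by (auto simp: less_Suc_eq_le)
    have tn: "t \<le> s + real ?n" using t(2) unfolding idx_def by linarith
    have segs_m: "segs s (Suc ?n) \<in> tilt s (s + real ?n) x \<rightarrow>\<^sub>M ?D"
      by (intro measurable_tilt[OF s] past_future[OF order_refl measurable_segs[OF order_refl]])
    have glue_restrict: "glue ?J (restrict w {0..<Suc ?n}) = glue ?J w" for w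
      using idxJ by (auto simp: glue_def fun_eq_iff image_subset_iff)
    have "path_marginal I \<E> R s t = distr ?L ?E ((\<lambda>w. restrict w ?J) \<circ> glue (I \<inter> {s..}))"
      unfolding path_marginal_def R_def by (rule distr_distr[OF measurable_restrict_subset[OF J] glue_L[OF order_refl]])
    also have "(\<lambda>w. restrict w ?J) \<circ> glue (I \<inter> {s..}) = glue ?J \<circ> (\<lambda>w. restrict w {0..<Suc ?n})"
      unfolding comp_def glue_restrict by (auto simp: glue_def fun_eq_iff)
    also have "distr ?L ?E (glue ?J \<circ> (\<lambda>w. restrict w {0..<Suc ?n})) = distr (distr ?L ?D (\<lambda>w. restrict w {0..<Suc ?n})) ?E (glue ?J)"
      by (rule distr_distr[symmetric, OF glue_m[OF J idxJ]]) (intro lim_m measurable_restrict_subset subset_UNIV)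
    also have "\<dots> = distr (tilt s (s + real ?n) x) ?E (glue ?J \<circ> segs s (Suc ?n))"
      unfolding C by (rule distr_distr[OF glue_m[OF J idxJ] segs_m])
    also have "glue ?J \<circ> segs s (Suc ?n) = path s t"
    proof (intro ext)
      fix \<omega> u
      show "(glue ?J \<circ> segs s (Suc ?n)) \<omega> u = path s t \<omega> u"
      proof (cases "u \<in> ?J")
        case True
        then have "idx u < Suc ?n" "u \<in> seg_times s (idx u)" using idx_le[of u] idx[of u] by (auto simp: less_Suc_eq_le)
        then show ?thesis using True by (simp add: glue_def segs_def seg_def)
      next
        case False
        then show ?thesis by (simp only: glue_def comp_apply restrict_apply if_False)
      qed
    qed
    \<comment> \<open>The segments cover a horizon rounded up to \<open>s + ?n\<close>;
      \<open>tilt_past\<close> cuts it back to \<open>t\<close>.\<close>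
    also have "distr (tilt s (s + real ?n) x) ?E (path s t) = distr (tilt s t x) ?E (path s t)"
    proof (rule measure_eqI)
      fix B assume "B \<in> sets (distr (tilt s (s + real ?n) x) ?E (path s t))"
      then have B: "B \<in> sets ?E" by simp
      have pm: "path s t \<in> tilt s T x \<rightarrow>\<^sub>M ?E" for T
        by (rule measurable_tilt[OF s past_future[OF order_refl measurable_path]])
      have g: "(\<lambda>\<omega>. indicator B (path s t \<omega>) :: ennreal) \<in> borel_measurable (past s t)"
        using B by (intro measurable_compose[OF measurable_path]) auto
      have e: "emeasure (distr (tilt s T x) ?E (path s t)) B = (\<integral>\<^sup>+\<omega>. indicator B (path s t \<omega>) \<partial>tilt s T x)" for T
        using nn_integral_distr[OF pm, of "indicator B"] B by simp
      show "emeasure (distr (tilt s (s + real ?n) x) ?E (path s t)) B = emeasure (distr (tilt s t x) ?E (path s t)) B"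
        unfolding e by (rule tilt_past[OF s t(1) time_add[OF s time_of_nat] t(2) tn g])
    qed simp
    also have "\<dots> = Q_law s t x" by (rule Q_law_tilt[OF s t x, symmetric])
    finally show ?thesis .
  qed
  ultimately show ?thesis by blast
qed

section \<open>Total variation bound and weak convergence\<close>

lemma tv_dist_cond_path_law:
  assumes st: "s \<in> I" "t \<in> I" "T \<in> I" "s \<le> t" "t \<le> T" and x: "x \<notin> A s"
  shows "tv_dist (PiM (I \<inter> {s..t}) (\<lambda>_. \<E>)) (cond_path_law I \<E> X P A s x t T) (Q_law s t x) \<le> 2 * rate (T - t)"
  unfolding tv_dist_def
proof (rule cSUP_least)
  let ?M = "PiM (I \<inter> {s..t}) (\<lambda>_. \<E>)"
  have "(\<lambda>_. 0) \<in> {f \<in> borel_measurable ?M. \<forall>y\<in>space ?M. \<bar>f y\<bar> \<le> (1::real)}" by simp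
  then show "{f \<in> borel_measurable ?M. \<forall>y\<in>space ?M. \<bar>f y\<bar> \<le> (1::real)} \<noteq> {}" by blast
  fix f assume "f \<in> {f \<in> borel_measurable ?M. \<forall>y\<in>space ?M. \<bar>f y\<bar> \<le> (1::real)}"
  then show "\<bar>(\<integral>y. f y \<partial>cond_path_law I \<E> X P A s x t T) - (\<integral>y. f y \<partial>Q_law s t x)\<bar> \<le> 2 * rate (T - t)"
    by (intro Q_law_integral_close[OF st x]) auto
qed

text \<open>Dividing the test function by its bound \<open>c\<close> reduces the claim to
  \<open>Q_law_integral_close\<close>; the restriction to \<open>T\<close> in \<open>I\<close> is
  carried by the filter.\<close>

lemma weakly_converges_cond_path_law:
  assumes st: "s \<in> I" "t \<in> I" "s \<le> t" and x: "x \<notin> A s"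
  shows "weakly_converges (product_topology (\<lambda>_. euclidean) (I \<inter> {s..t})) (PiM (I \<inter> {s..t}) (\<lambda>_. \<E>))
    (\<lambda>T. cond_path_law I \<E> X P A s x t T) (Q_law s t x) (inf at_top (principal I))"
  unfolding weakly_converges_def
proof (intro allI impI)
  let ?M = "PiM (I \<inter> {s..t}) (\<lambda>_. \<E>)" and ?F = "inf at_top (principal I)"
  fix f :: "(real \<Rightarrow> 'e) \<Rightarrow> real"
  assume f: "f \<in> borel_measurable ?M"
    and b: "bounded (f ` topspace (product_topology (\<lambda>_. euclidean) (I \<inter> {s..t})))"
  have sp: "topspace (product_topology (\<lambda>_. euclidean) (I \<inter> {s..t})) = space ?M"
    by (simp add: space_PiM space_state)
  from b obtain c where c: "0 < c" "\<And>y. y \<in> space ?M \<Longrightarrow> \<bar>f y\<bar> \<le> c"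
    unfolding sp bounded_pos by auto
  let ?d = "\<lambda>T. (\<integral>y. f y \<partial>cond_path_law I \<E> X P A s x t T) - (\<integral>y. f y \<partial>Q_law s t x)"
  have bound: "norm (?d T) \<le> c * (2 * rate (T - t))" if "T \<in> I" "t \<le> T" for T
  proof -
    have "\<bar>(\<integral>y. f y / c \<partial>cond_path_law I \<E> X P A s x t T) - (\<integral>y. f y / c \<partial>Q_law s t x)\<bar> \<le> 2 * rate (T - t)"
      using f c st x that by (intro Q_law_integral_close) (auto simp: divide_le_eq)
    then have "\<bar>?d T / c\<bar> \<le> 2 * rate (T - t)" by (simp add: diff_divide_distrib)
    then show ?thesis using c by (simp add: abs_div_pos[symmetric] field_simps)
  qed
  have "eventually (\<lambda>T. T \<in> I \<longrightarrow> norm (?d T) \<le> c * (2 * rate (T - t))) at_top"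
    using eventually_ge_at_top[of t] by (rule eventually_mono) (use bound in blast)
  then have ev: "eventually (\<lambda>T. norm (?d T) \<le> c * (2 * rate (T - t))) ?F"
    by (simp add: eventually_inf_principal)
  have "((\<lambda>T. c * (2 * rate (T - t))) \<longlongrightarrow> c * (2 * 0)) at_top"
    by (intro tendsto_mult tendsto_const rate_tendsto)
  then have "((\<lambda>T. c * (2 * rate (T - t))) \<longlongrightarrow> 0) ?F"
    by (simp only: mult_zero_right) (rule tendsto_mono[OF inf_le1])
  then have "(?d \<longlongrightarrow> 0) ?F" by (rule Lim_null_comparison[OF ev])
  then show "((\<lambda>T. \<integral>y. f y \<partial>cond_path_law I \<E> X P A s x t T) \<longlongrightarrow> (\<integral>y. f y \<partial>Q_law s t x)) ?F"
    by (rule LIM_zero_cancel)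
qed

end

theorem theorem1:
  fixes I :: "real set"
    and \<Omega> :: "'w set"
    and \<E> :: "('e::metric_space) measure"
    and X :: "real \<Rightarrow> 'w \<Rightarrow> 'e"
    and P :: "real \<Rightarrow> 'e \<Rightarrow> 'w measure"
    and A :: "real \<Rightarrow> 'e set"
    and \<nu> :: "real \<Rightarrow> 'e measure"
    and t0 c1 c2 :: real
  assumes process: "absorbed_markov_process I \<Omega> \<E> X P A"
    and nu: "\<And>s. s \<in> I \<Longrightarrow> \<nu> s \<in> prob_measures_on \<E> (- A s)"
    and t0: "t0 \<in> I" "t0 > 0"
    and c1: "c1 > 0"
    and c2: "c2 > 0"
    and A'1: "\<And>s x B. \<lbrakk>s \<in> I; x \<in> - A s; B \<in> sets \<E>\<rbrakk> \<Longrightarrow>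
      \<P>(\<omega> in P s x. X (s + t0) \<omega> \<in> B \<bar> hitting_time I X A s \<omega> > ereal (s + t0))
        \<ge> c1 * measure (\<nu> (s + t0)) B"
    and A'2: "\<And>s t x. \<lbrakk>s \<in> I; t \<in> I; s \<le> t; x \<in> - A s\<rbrakk> \<Longrightarrow>
      \<P>(\<omega> in \<nu> s \<bind> P s. hitting_time I X A s \<omega> > ereal t)
        \<ge> c2 * \<P>(\<omega> in P s x. hitting_time I X A s \<omega> > ereal t)"
  shows "\<exists>Q. is_Q_process I \<E> X P A Q \<and>
    (\<exists>C>0. \<exists>\<gamma>>0. \<forall>s\<in>I. \<forall>t\<in>I. \<forall>T\<in>I. \<forall>x \<in> - A s. s \<le> t \<longrightarrow> t \<le> T \<longrightarrow>
      tv_dist (PiM (I \<inter> {s..t}) (\<lambda>_. \<E>))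
        (cond_path_law I \<E> X P A s x t T)
        (path_marginal I \<E> (Q s x) s t)
      \<le> C * exp (- \<gamma> * (T - t)))"
proof -
  interpret absorbed_markov_process I \<Omega> \<E> X P A by (rule process)
  interpret doeblin_absorbed_process I \<Omega> \<E> X P A \<nu> t0 c1 c2
    by unfold_locales (fact nu t0 c1 c2 A'1 A'2)+
  \<comment> \<open>With the implication inside the existential, \<open>Q\<close> can be chosen for
    all \<open>s\<close> and \<open>x\<close> at once, arbitrarily where \<open>x\<close> is
    absorbed.\<close>
  have "\<forall>s x. \<exists>R. s \<in> I \<and> x \<notin> A s \<longrightarrow> R \<in> space (prob_algebra (PiM (I \<inter> {s..}) (\<lambda>_. \<E>))) \<and>
      (\<forall>t\<in>I. s \<le> t \<longrightarrow> path_marginal I \<E> R s t = Q_law s t x)"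
    using Q_law_extension by blast
  then obtain Q where Q: "\<And>s x. s \<in> I \<Longrightarrow> x \<notin> A s \<Longrightarrow> Q s x \<in> space (prob_algebra (PiM (I \<inter> {s..}) (\<lambda>_. \<E>)))"
    "\<And>s x t. s \<in> I \<Longrightarrow> x \<notin> A s \<Longrightarrow> t \<in> I \<Longrightarrow> s \<le> t \<Longrightarrow> path_marginal I \<E> (Q s x) s t = Q_law s t x"
    by metis
  have "is_Q_process I \<E> X P A Q"
    unfolding is_Q_process_def using Q weakly_converges_cond_path_law by simp
  \<comment> \<open>These are the two constants of the claim, read off from
    \<open>2 * rate (T - t)\<close>.\<close>
  moreover have "0 < 2 * exp (2 * \<gamma>) / \<gamma>" "0 < \<gamma> / t0" using gamma t0 by auto
  moreover have "tv_dist (PiM (I \<inter> {s..t}) (\<lambda>_. \<E>)) (cond_path_law I \<E> X P A s x t T) (path_marginal I \<E> (Q s x) s t)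
      \<le> 2 * exp (2 * \<gamma>) / \<gamma> * exp (- (\<gamma> / t0) * (T - t))"
    if "s \<in> I" "t \<in> I" "T \<in> I" "x \<in> - A s" "s \<le> t" "t \<le> T" for s t T x
    using tv_dist_cond_path_law[of s t T x] Q(2)[of s x t] that by (simp add: rate_def)
  ultimately show ?thesis by blast
qed

end
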